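(* Let $a<1$ be real and let $f$ be analytic and polynomially bounded in the strip $\{s=\sigma+it: a\le\sigma\le 1,\ t\ge 1\}$, with order function $\mu$ satisfying $0<\mu(a)<\infty$ and $\mu(1)=0$. Then $1/\mu$ is convex if and only if the family $\sigma_p(\alpha)$ of $L^p$ abscissae of $f$ is approximately concave.
   Context: Write $s=\sigma+it$. "Polynomially bounded" means $|f(\sigma+it)|\le C t^{A}$ for some constants $A,C$, all $a\le\sigma\le1$ and $t\ge1$. Order function: $\mu(\sigma)=\inf\{\mu\ge 0: f(\sigma+it)\ll t^{\mu}\ (t\ge 1)\}$ for $a\le\sigma\le 1$. By the Phragmén–Lindelöf theorem $\mu$ is convex and (since $\mu\ge0$, $\mu(1)=0$) non-increasing on $[a,1]$. "$1/\mu$ is convex" means that $\sigma\mapsto 1/\mu(\sigma)$ is convex on the interval $\{\sigma\in[a,1]:\mu(\sigma)>0\}$ (equivalently, convex on $[a,1]$ with value $+\infty$ where $\mu=0$). $L^p$ abscissae: for real $p>0$ and $1<\alpha\le\mu(a)p$, $$\sigma_p(\alpha)=\inf\Big\{\sigma\in[a,1]: \Big(\int_1^\infty |f(\sigma+it)|^p\,\frac{dt}{t^\alpha}\Big)^{1/p}<\infty\Big\}.$$ Approximate concavity: the family of non-decreasing functions $p\mapsto\sigma_p(\alpha)$ (defined for $p\ge\alpha/\mu(a)$) is approximately concave if $$\phi\,\sigma_q(\alpha)+(1-\phi)\,\sigma_r(\alpha)\le\sigma_p(\alpha)+o(1)\qquad(p\to\infty)$$ when $p=\phi q+(1-\phi)r$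 and $0\le\phi\le1$, uniformly for $1<\alpha\le\mu(a)\min(q,r)$. That is: for every $\varepsilon>0$ there is $P$ such that for all $q,r>0$, $\phi\in[0,1]$ with $p=\phi q+(1-\phi)r\ge P$, and all $\alpha$ with $1<\alpha\le\mu(a)\min(q,r)$, one has $\phi\,\sigma_q(\alpha)+(1-\phi)\,\sigma_r(\alpha)\le\sigma_p(\alpha)+\varepsilon$. *)

theory Defs
  imports "HOL-Analysis.Analysis"
begin

definition half_strip :: "real \<Rightarrow> complex set" where
  "half_strip a = {s. a \<le> Re s \<and> Re s \<le> 1 \<and> 1 \<le> Im s}"

definition polynomially_bounded :: "real \<Rightarrow> (complex \<Rightarrow> complex) \<Rightarrow> bool" where
  "polynomially_bounded a f \<longleftrightarrow>
     (\<exists>A C :: real. \<forall>\<sigma>\<in>{a..1}. \<forall>t\<ge>1. norm (f (Complex \<sigma> t)) \<le> C * t powr A)"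

(* Inf on the reals is unspecified for the empty set; for a polynomially bounded f
   and a <= \<sigma> <= 1 the set is nonempty, and it is always bounded below by 0. *)
definition order_fun :: "(complex \<Rightarrow> complex) \<Rightarrow> real \<Rightarrow> real" where
  "order_fun f \<sigma> =
     Inf {m. 0 \<le> m \<and> (\<exists>C::real. \<forall>t\<ge>1. norm (f (Complex \<sigma> t)) \<le> C * t powr m)}"

(* The integral of |f(\<sigma> + it)|^p t^(-\<alpha>) over t >= 1 as an extended nonnegative real:
   the p-th power of the L^p norm on the line Re s = \<sigma>.  For p > 0 the norm, its 1/p-th power,
   is finite iff the integral itself is. *)
definition Lp_integral :: "(complex \<Rightarrow> complex) \<Rightarrow> real \<Rightarrow> real \<Rightarrow> real \<Rightarrow> ennreal" where
  "Lp_integral f p \<alpha> \<sigma> =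
     (\<integral>\<^sup>+t\<in>{1..}. ennreal (norm (f (Complex \<sigma> t)) powr p / t powr \<alpha>) \<partial>lborel)"

(* If order_fun f 1 = 0, p > 0 and \<alpha> > 1, the set contains 1, so it is nonempty. *)
definition Lp_abscissa :: "real \<Rightarrow> (complex \<Rightarrow> complex) \<Rightarrow> real \<Rightarrow> real \<Rightarrow> real" where
  "Lp_abscissa a f p \<alpha> = Inf {\<sigma>\<in>{a..1}. Lp_integral f p \<alpha> \<sigma> < \<infinity>}"

(* S p \<alpha> is meant for 1 < \<alpha> <= M * p.  The bound P depends on \<epsilon> only: the o(1) term as
   p tends to infinity is uniform in q, r, \<phi> and \<alpha>. *)
definition approximately_concave :: "real \<Rightarrow> (real \<Rightarrow> real \<Rightarrow> real) \<Rightarrow> bool" where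
  "approximately_concave M S \<longleftrightarrow>
     (\<forall>\<epsilon>>0. \<exists>P. \<forall>q>0. \<forall>r>0. \<forall>\<phi>\<in>{0..1}. \<forall>p. \<forall>\<alpha>.
        p = \<phi> * q + (1 - \<phi>) * r \<longrightarrow> P \<le> p \<longrightarrow> 1 < \<alpha> \<longrightarrow> \<alpha> \<le> M * min q r \<longrightarrow>
        \<phi> * S q \<alpha> + (1 - \<phi>) * S r \<alpha> \<le> S p \<alpha> + \<epsilon>)"

end

theory Submission
  imports Defs "HOL-Complex_Analysis.Conformal_Mappings"
begin

text \<open>
  The generalised inverse \<open>level y = inf {\<sigma>. \<mu> \<sigma> \<le> y}\<close> of the order function is approximated by the
  \<open>L\<^sup>p\<close> abscissae: \<open>level (\<alpha> / p) \<le> \<sigma>\<^sub>p(\<alpha>) \<le> level ((\<alpha> - 1) / p)\<close>, the first inequality for \<open>p \<ge> 1\<close>.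
  The second inequality is immediate. For the first one, if the integral converges on the line
  \<open>\<sigma>\<^sub>1\<close>, then Cauchy's formula on the rectangle \<open>[\<sigma>\<^sub>1, 1] \<times> [t/2, 3t/2]\<close> with the kernel
  \<open>exp ((w - s)\<^sup>2) / (w - s)\<close> yields \<open>f s = O(t powr (\<alpha> / p))\<close> to the right of that line.
  By convexity of \<open>\<mu>\<close> and \<open>\<mu> 1 = 0\<close>, the two bounds differ by at most \<open>(1 - a) / \<alpha>\<close>. On the other
  hand, \<open>1 / \<mu>\<close> is convex iff its inverse \<open>x \<mapsto> level (1 / x)\<close> is concave on \<open>x \<ge> 1 / \<mu> a\<close>, and
  \<open>\<alpha> / p = 1 / x\<close> translates this into concavity in \<open>p\<close> when \<open>\<alpha>\<close> is large. When \<open>\<alpha>\<close> stays bounded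
  and \<open>p\<close> tends to infinity, \<open>\<sigma>\<^sub>p(\<alpha>)\<close> tends to \<open>level 0\<close>, which bounds all abscissae from above.
\<close>

subsection \<open>Convex order functions and their inverses\<close>

lemma combination_le_max:
  fixes x y c \<phi> :: real
  assumes "x \<le> c" "y \<le> c" "0 \<le> \<phi>" "\<phi> \<le> 1"
  shows "\<phi> * x + (1 - \<phi>) * y \<le> c"
  using convex_bound_le[of x c y \<phi> "1 - \<phi>"] assms by simp

locale convex_order =
  fixes a :: real and \<mu> :: "real \<Rightarrow> real"
  assumes a_less_1: "a < 1"
    and convex_\<mu>: "convex_on {a..1} \<mu>"
    and \<mu>_nonneg: "\<sigma> \<in> {a..1} \<Longrightarrow> 0 \<le> \<mu> \<sigma>"
    and \<mu>_1: "\<mu> 1 = 0"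
begin

text \<open>The infimum need not be attained: if \<open>\<mu>\<close> jumps at \<open>a\<close>, the
  set can be the interval from \<open>a\<close> to 1 without \<open>a\<close>. For negative
  \<open>y\<close> the set is empty, hence the hypotheses \<open>0 \<le> y\<close> below.\<close>

definition level :: "real \<Rightarrow> real" where
  "level y = Inf {\<sigma>\<in>{a..1}. \<mu> \<sigma> \<le> y}"

lemma \<mu>_combination_le:
  assumes "x \<in> {a..1}" "y \<in> {a..1}" "0 \<le> u" "u \<le> 1"
  shows "\<mu> ((1 - u) * x + u * y) \<le> (1 - u) * \<mu> x + u * \<mu> y"
  using convex_onD[OF convex_\<mu>, of u x y] assms by simp

text \<open>Convexity along the chord from \<open>\<sigma>\<close> to 1, whose right end has height
  0. Both monotonicity lemmas and \<open>level_shrink\<close> rest on it.\<close>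

lemma \<mu>_towards_1_le:
  assumes "\<sigma> \<in> {a..1}" "0 \<le> u" "u \<le> 1"
  shows "\<mu> (\<sigma> + u * (1 - \<sigma>)) \<le> (1 - u) * \<mu> \<sigma>"
proof -
  have "\<sigma> + u * (1 - \<sigma>) = (1 - u) * \<sigma> + u * 1" by (simp add: algebra_simps)
  with \<mu>_combination_le[of \<sigma> 1 u] show ?thesis using assms a_less_1 \<mu>_1 by simp
qed

lemma \<mu>_strict:
  assumes "\<sigma> \<in> {a..1}" "\<tau> \<in> {a..1}" "\<sigma> < \<tau>" "0 < \<mu> \<sigma>"
  shows "\<mu> \<tau> < \<mu> \<sigma>"
proof -
  define u where "u = (\<tau> - \<sigma>) / (1 - \<sigma>)"
  have u: "0 < u" "u \<le> 1" "\<sigma> + u * (1 - \<sigma>) = \<tau>"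
    using assms by (auto simp: u_def field_simps)
  then have "\<mu> \<tau> \<le> (1 - u) * \<mu> \<sigma>" using \<mu>_towards_1_le[of \<sigma> u] assms by simp
  also have "\<dots> < \<mu> \<sigma>" using u assms by (simp add: algebra_simps)
  finally show ?thesis .
qed

lemma \<mu>_antimono:
  assumes "\<sigma> \<in> {a..1}" "\<tau> \<in> {a..1}" "\<sigma> \<le> \<tau>"
  shows "\<mu> \<tau> \<le> \<mu> \<sigma>"
proof (cases "\<sigma> = \<tau>")
  case False
  define u where "u = (\<tau> - \<sigma>) / (1 - \<sigma>)"
  have u: "0 < u" "u \<le> 1" "\<sigma> + u * (1 - \<sigma>) = \<tau>"
    using assms False by (auto simp: u_def field_simps)
  then have "\<mu> \<tau> \<le> (1 - u) * \<mu> \<sigma>" using \<mu>_towards_1_le[of \<sigma> u] assms by simp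
  also have "\<dots> \<le> \<mu> \<sigma>" using u \<mu>_nonneg[OF assms(1)] by (simp add: algebra_simps)
  finally show ?thesis .
qed simp

lemma
  assumes "0 \<le> y"
  shows level_ge: "a \<le> level y" and level_le_1: "level y \<le> 1"
proof -
  have "1 \<in> {\<sigma>\<in>{a..1}. \<mu> \<sigma> \<le> y}" using a_less_1 assms \<mu>_1 by simp
  then show "a \<le> level y" "level y \<le> 1"
    unfolding level_def by (auto intro!: cInf_greatest cInf_lower bdd_belowI[of _ a])
qed

lemma level_lower:
  assumes "\<sigma> \<in> {a..1}" "\<mu> \<sigma> \<le> y"
  shows "level y \<le> \<sigma>"
  unfolding level_def using assms by (intro cInf_lower) (auto intro: bdd_belowI[of _ a])

lemma le_level:
  assumes "0 \<le> y" "\<And>\<sigma>. \<sigma> \<in> {a..1} \<Longrightarrow> \<mu> \<sigma> \<le> y \<Longrightarrow> s \<le> \<sigma>"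
  shows "s \<le> level y"
  unfolding level_def using assms a_less_1 \<mu>_1 by (intro cInf_greatest) auto

lemma level_antimono: "0 \<le> x \<Longrightarrow> x \<le> y \<Longrightarrow> level y \<le> level x"
  by (intro le_level level_lower) auto

lemma \<mu>_above_level:
  assumes "0 \<le> y" "\<sigma> \<in> {a..1}" "level y < \<sigma>"
  shows "\<mu> \<sigma> \<le> y"
proof -
  obtain \<tau> where "\<tau> \<in> {a..1}" "\<mu> \<tau> \<le> y" "\<tau> < \<sigma>"
    using assms le_level[of y \<sigma>] by force
  then show ?thesis using \<mu>_antimono[of \<tau> \<sigma>] assms by simp
qed

text \<open>Some \<open>\<tau>\<close> left of \<open>\<sigma>\<close> already has
  \<open>\<mu> \<tau> \<le> y\<close>. Either \<open>\<mu> \<tau> = 0 < y\<close>, or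
  \<open>\<mu>\<close> decreases strictly from \<open>\<tau>\<close> on to
  \<open>\<sigma>\<close>.\<close>

lemma \<mu>_above_level_strict:
  assumes "0 < y" "\<sigma> \<in> {a..1}" "level y < \<sigma>"
  shows "\<mu> \<sigma> < y"
proof -
  obtain \<tau> where \<tau>: "\<tau> \<in> {a..1}" "\<mu> \<tau> \<le> y" "\<tau> < \<sigma>"
    using assms le_level[of y \<sigma>] by force
  show ?thesis
  proof (cases "\<mu> \<tau> = 0")
    case True
    then show ?thesis using \<mu>_antimono[of \<tau> \<sigma>] \<tau> assms by simp
  next
    case False
    then show ?thesis using \<mu>_strict[of \<tau> \<sigma>] \<mu>_nonneg[of \<tau>] \<tau> assms by simp
  qed
qed

text \<open>Contrapositive of the strict bound. For \<open>y = 0\<close> this can fail, since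
  \<open>0 \<le> \<mu> \<sigma>\<close> also holds beyond the first zero of
  \<open>\<mu>\<close>.\<close>

lemma le_levelI:
  assumes "\<sigma> \<in> {a..1}" "0 < y" "y \<le> \<mu> \<sigma>"
  shows "\<sigma> \<le> level y"
  using assms \<mu>_above_level_strict[of y \<sigma>] by force

text \<open>
  The function \<open>\<mu>\<close> may jump at \<open>a\<close>, because the domain of analyticity may shrink to the closed
  half strip as \<open>t\<close> grows; hence the hypothesis \<open>y \<le> \<mu> a\<close>.
\<close>

lemma le_\<mu>I:
  assumes "\<sigma> \<in> {a..1}" "0 \<le> y" "\<sigma> \<le> level y" "y \<le> \<mu> a"
  shows "y \<le> \<mu> \<sigma>"
proof (rule ccontr)
  assume "\<not> y \<le> \<mu> \<sigma>"
  then have less: "\<mu> \<sigma> < y" and "a < \<sigma>" using assms by (cases "\<sigma> = a"; simp)+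
  \<comment> \<open>Moving from \<open>\<sigma>\<close> by the fraction \<open>u\<close> towards
    \<open>a\<close> raises the convexity bound by less than the gap
    \<open>y - \<mu> \<sigma>\<close>. The point reached lies strictly left of
    \<open>\<sigma>\<close> and still has order below \<open>y\<close>, which contradicts
    \<open>\<sigma> \<le> level y\<close>.\<close>
  define u where "u = (y - \<mu> \<sigma>) / (2 * (y - \<mu> \<sigma> + \<mu> a))"
  have Ma: "0 < \<mu> a" using less assms \<mu>_nonneg[of \<sigma>] by simp
  have u: "0 < u" "u \<le> 1" using less Ma by (auto simp: u_def field_simps)
  have "u * \<mu> a < y - \<mu> \<sigma>"
  proof -
    define d where "d = y - \<mu> \<sigma>"
    have d: "0 < d" using less by (simp add: d_def)
    then have "d * \<mu> a < d * (2 * (d + \<mu> a))" using Ma by (intro mult_strict_left_mono) auto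
    then have "d / (2 * (d + \<mu> a)) * \<mu> a < d" using d Ma by (simp add: divide_less_eq)
    then show ?thesis by (simp add: u_def d_def)
  qed
  then have "(1 - u) * \<mu> \<sigma> + u * \<mu> a < y"
    using mult_right_mono[of "1 - u" 1 "\<mu> \<sigma>"] u \<mu>_nonneg[OF assms(1)] by simp
  then have "\<mu> ((1 - u) * \<sigma> + u * a) < y"
    using \<mu>_combination_le[of \<sigma> a u] assms u a_less_1 by simp
  moreover have eq: "(1 - u) * \<sigma> + u * a = \<sigma> - u * (\<sigma> - a)" by (simp add: algebra_simps)
  moreover have "u * (\<sigma> - a) \<le> 1 * (\<sigma> - a)"
    using u \<open>a < \<sigma>\<close> by (intro mult_right_mono) auto
  moreover have "0 < u * (\<sigma> - a)" using u \<open>a < \<sigma>\<close> by simp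
  ultimately have "level y \<le> \<sigma> - u * (\<sigma> - a)"
    using assms by (intro level_lower) auto
  with \<open>0 < u * (\<sigma> - a)\<close> assms show False by simp
qed

text \<open>Going the fraction \<open>u\<close> of the way from a point of order at most
  \<open>y\<close> to 1 multiplies the bound by \<open>1 - u\<close> and moves the point by at most
  \<open>u * (1 - a)\<close>.\<close>

lemma level_shrink:
  assumes "0 \<le> y" "0 \<le> u" "u \<le> 1"
  shows "level ((1 - u) * y) \<le> level y + u * (1 - a)"
proof (rule field_le_epsilon)
  fix e :: real assume "0 < e"
  \<comment> \<open>The slack \<open>e\<close> makes up for an infimum that is not attained. The cap
    at 1, where \<open>\<mu>\<close> vanishes, keeps the point in the interval.\<close>
  define \<sigma> where "\<sigma> = min 1 (level y + e)"
  have *: "\<sigma> \<in> {a..1}" "\<sigma> \<le> level y + e"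
    using a_less_1 level_ge[OF assms(1)] level_le_1[OF assms(1)] \<open>0 < e\<close> by (auto simp: \<sigma>_def)
  have "\<mu> \<sigma> \<le> y"
    using \<mu>_above_level[of y \<sigma>] assms * \<mu>_1 \<open>0 < e\<close> by (cases "\<sigma> = 1") (auto simp: \<sigma>_def)
  then have "\<mu> (\<sigma> + u * (1 - \<sigma>)) \<le> (1 - u) * y"
    using \<mu>_towards_1_le[of \<sigma> u] * assms mult_left_mono[of "\<mu> \<sigma>" y "1 - u"] by simp
  moreover have "u * (1 - \<sigma>) \<le> 1 * (1 - \<sigma>)" "0 \<le> u * (1 - \<sigma>)" "u * (1 - \<sigma>) \<le> u * (1 - a)"
    using assms * by (intro mult_right_mono mult_left_mono mult_nonneg_nonneg; simp)+
  ultimately have "level ((1 - u) * y) \<le> \<sigma> + u * (1 - \<sigma>)"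
    using * by (intro level_lower) auto
  with * \<open>u * (1 - \<sigma>) \<le> u * (1 - a)\<close> show "level ((1 - u) * y) \<le> level y + u * (1 - a) + e" by simp
qed

text \<open>Continuity at 0 from the right: the point \<open>level 0 - e\<close> has positive order,
  and this order serves as \<open>y\<close>. If the point lies left of \<open>a\<close>, any
  \<open>y\<close> will do because levels are at least \<open>a\<close>.\<close>

lemma level_continuous_0:
  assumes "0 < e"
  obtains y where "0 < y" "level 0 - e \<le> level y"
proof (cases "a \<le> level 0 - e")
  case True
  then have "level 0 - e \<in> {a..1}" using level_le_1[of 0] assms by simp
  moreover from this have "0 < \<mu> (level 0 - e)"
    using \<mu>_nonneg[of "level 0 - e"] level_lower[of "level 0 - e" 0] assms by force
  ultimately show ?thesis using that[of "\<mu> (level 0 - e)"] le_levelI by auto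
next
  case False
  then show ?thesis using that[of 1] level_ge[of 1] by simp
qed

text \<open>Points \<open>\<sigma>\<close> and \<open>\<tau>\<close> at or just below the two levels
  satisfy \<open>1 / \<mu> \<sigma> \<le> x\<close> and \<open>1 / \<mu> \<tau> \<le> y\<close>.
  Convexity bounds \<open>1 / \<mu>\<close> at their combination, and \<open>le_levelI\<close> puts
  this combination below the level on the right.\<close>

lemma concave_levels:
  assumes conv: "convex_on {\<sigma>\<in>{a..1}. 0 < \<mu> \<sigma>} (\<lambda>\<sigma>. 1 / \<mu> \<sigma>)"
    and x: "0 < x" "1 / x \<le> \<mu> a" and y: "0 < y" "1 / y \<le> \<mu> a"
    and \<phi>: "0 \<le> \<phi>" "\<phi> \<le> 1"
  shows "\<phi> * level (1 / x) + (1 - \<phi>) * level (1 / y) \<le> level (1 / (\<phi> * x + (1 - \<phi>) * y))"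
proof (rule field_le_epsilon)
  fix e :: real assume "0 < e"
  have aux: "\<exists>\<sigma>\<in>{a..1}. 0 < \<mu> \<sigma> \<and> 1 / \<mu> \<sigma> \<le> z \<and> level (1 / z) - e \<le> \<sigma>"
    if z: "0 < z" "1 / z \<le> \<mu> a" for z
  proof -
    define \<sigma> where "\<sigma> = max a (level (1 / z) - e)"
    have \<sigma>: "\<sigma> \<in> {a..1}"
      using a_less_1 level_le_1[of "1 / z"] z \<open>0 < e\<close> by (auto simp: \<sigma>_def)
    \<comment> \<open>Here \<open>1 / z \<le> \<mu> a\<close> enters, which excludes values above
      the range of \<open>\<mu>\<close>.\<close>
    have "1 / z \<le> \<mu> \<sigma>"
      using le_\<mu>I[of \<sigma> "1 / z"] \<sigma> z level_ge[of "1 / z"] \<open>0 < e\<close> by (simp add: \<sigma>_def)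
    moreover from this have "0 < \<mu> \<sigma>" using z by (smt (verit) zero_less_divide_1_iff)
    moreover from calculation have "1 / \<mu> \<sigma> \<le> z" using z by (simp add: field_simps)
    ultimately show ?thesis using \<sigma> by (auto simp: \<sigma>_def)
  qed
  obtain \<sigma> where \<sigma>: "\<sigma> \<in> {a..1}" "0 < \<mu> \<sigma>" "1 / \<mu> \<sigma> \<le> x" "level (1 / x) - e \<le> \<sigma>"
    using aux[OF x] by blast
  obtain \<tau> where \<tau>: "\<tau> \<in> {a..1}" "0 < \<mu> \<tau>" "1 / \<mu> \<tau> \<le> y" "level (1 / y) - e \<le> \<tau>"
    using aux[OF y] by blast
  let ?z = "\<phi> * x + (1 - \<phi>) * y" and ?\<rho> = "\<phi> * \<sigma> + (1 - \<phi>) * \<tau>"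
  have z: "0 < ?z"
    using x y \<phi> by (cases "\<phi> = 0") (auto intro!: add_pos_nonneg)
  \<comment> \<open>Convexity of the domain is part of \<open>convex_on\<close>; it keeps the
    combination where \<open>\<mu>\<close> is positive.\<close>
  have "?\<rho> \<in> {s\<in>{a..1}. 0 < \<mu> s}"
    using convexD[OF convex_on_imp_convex[OF conv], of \<sigma> \<tau> \<phi> "1 - \<phi>"] \<sigma> \<tau> \<phi> by simp
  then have \<rho>: "?\<rho> \<in> {a..1}" "0 < \<mu> ?\<rho>" by auto
  have "1 / \<mu> ?\<rho> \<le> \<phi> * (1 / \<mu> \<sigma>) + (1 - \<phi>) * (1 / \<mu> \<tau>)"
    using convex_onD[OF conv, of "1 - \<phi>" \<sigma> \<tau>] \<sigma> \<tau> \<phi> by simp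
  also have "\<dots> \<le> ?z" using \<sigma> \<tau> \<phi> by (intro add_mono mult_left_mono) auto
  finally have "1 / ?z \<le> \<mu> ?\<rho>" using \<rho> z by (simp add: field_simps)
  then have "?\<rho> \<le> level (1 / ?z)" using \<rho> z by (intro le_levelI) auto
  moreover have "\<phi> * (level (1 / x) - e) + (1 - \<phi>) * (level (1 / y) - e) \<le> ?\<rho>"
    using \<sigma> \<tau> \<phi> by (intro add_mono mult_left_mono) auto
  ultimately show "\<phi> * level (1 / x) + (1 - \<phi>) * level (1 / y) \<le> level (1 / ?z) + e"
    by (simp add: algebra_simps)
qed

section \<open>The equivalence for an abstract family enclosed between two levels\<close>

lemma level_sub_1_le:
  assumes "0 < p" "1 < \<alpha>"
  shows "level ((\<alpha> - 1) / p) \<le> level (\<alpha> / p) + (1 - a) / \<alpha>"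
proof -
  \<comment> \<open>Shrinking by \<open>u = 1 / \<alpha>\<close> turns one bound into the other. The
    cost does not involve \<open>p\<close>, which gives the uniformity needed later.\<close>
  have "(1 - 1 / \<alpha>) * (\<alpha> / p) = (\<alpha> - 1) / p" using assms by (simp add: field_simps)
  with level_shrink[of "\<alpha> / p" "1 / \<alpha>"] show ?thesis using assms by simp
qed

text \<open>Of the abscissae only the enclosure between two levels enters, so \<open>S\<close> is
  any family with these bounds. The restriction \<open>1 \<le> p\<close> in \<open>lower\<close> is
  met by a threshold of at least 1 in one direction and by a large \<open>\<alpha>\<close> in the
  other.\<close>

theorem convex_iff_approximately_concave:
  assumes \<mu>_a: "0 < \<mu> a"
    and lower: "\<And>p \<alpha>. 1 \<le> p \<Longrightarrow> 1 < \<alpha> \<Longrightarrow> level (\<alpha> / p) \<le> S p \<alpha>"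
    and upper: "\<And>p \<alpha>. 0 < p \<Longrightarrow> 1 < \<alpha> \<Longrightarrow> S p \<alpha> \<le> level ((\<alpha> - 1) / p)"
  shows "convex_on {\<sigma>\<in>{a..1}. 0 < \<mu> \<sigma>} (\<lambda>\<sigma>. 1 / \<mu> \<sigma>) \<longleftrightarrow> approximately_concave (\<mu> a) S"
proof
  assume conv: "convex_on {\<sigma>\<in>{a..1}. 0 < \<mu> \<sigma>} (\<lambda>\<sigma>. 1 / \<mu> \<sigma>)"
  show "approximately_concave (\<mu> a) S"
    unfolding approximately_concave_def
  proof (intro allI impI)
    fix \<epsilon> :: real assume "0 < \<epsilon>"
    obtain y where y: "0 < y" "level 0 - \<epsilon> \<le> level y"
      using level_continuous_0[OF \<open>0 < \<epsilon>\<close>] .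
    \<comment> \<open>For \<open>\<alpha> > K\<close> the gap \<open>(1 - a) / \<alpha>\<close>
      between the two bounds is below \<open>\<epsilon>\<close>.\<close>
    define K where "K = (1 - a) / \<epsilon>"
    have "0 < K" using a_less_1 \<open>0 < \<epsilon>\<close> by (simp add: K_def)
    \<comment> \<open>In the threshold for \<open>p\<close>, the 1 admits the lower bound, and
      \<open>K / y\<close> forces \<open>\<alpha> / p \<le> y\<close> whenever
      \<open>\<alpha> \<le> K\<close>. In that range the combination is at most
      \<open>level 0\<close>, while \<open>S p \<alpha>\<close> is at least
      \<open>level y\<close>.\<close>
    have "\<phi> * S q \<alpha> + (1 - \<phi>) * S r \<alpha> \<le> S p \<alpha> + \<epsilon>"
      if q: "0 < q" and r: "0 < r" and \<phi>: "\<phi> \<in> {0..1}" and p: "p = \<phi> * q + (1 - \<phi>) * r"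
        and P: "max 1 (K / y) \<le> p" and \<alpha>: "1 < \<alpha>" "\<alpha> \<le> \<mu> a * min q r" for q r \<phi> p \<alpha>
    proof (cases "\<alpha> \<le> K")
      case True
      have "S q \<alpha> \<le> level 0" "S r \<alpha> \<le> level 0"
        using upper[OF q \<alpha>(1)] upper[OF r \<alpha>(1)] q r \<alpha>
          level_antimono[of 0 "(\<alpha> - 1) / q"] level_antimono[of 0 "(\<alpha> - 1) / r"]
        by (auto intro: order_trans)
      then have "\<phi> * S q \<alpha> + (1 - \<phi>) * S r \<alpha> \<le> level 0"
        using \<phi> by (intro combination_le_max) auto
      also have "\<dots> \<le> level y + \<epsilon>" using y by simp
      also have "level y \<le> level (\<alpha> / p)"
      proof (rule level_antimono)
        have "K \<le> y * p" using P y by (simp add: field_simps)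
        then show "\<alpha> / p \<le> y" using True P by (simp add: field_simps)
      qed (use P \<alpha> in simp)
      also have "\<dots> \<le> S p \<alpha>" using P \<alpha> by (intro lower) auto
      finally show ?thesis by simp
    next
      case False
      have le: "(1 - a) / \<alpha> \<le> \<epsilon>"
        using False \<open>0 < \<epsilon>\<close> \<alpha> by (simp add: K_def field_simps)
      \<comment> \<open>These become the conditions \<open>1 / x \<le> \<mu> a\<close> and
        \<open>1 / y \<le> \<mu> a\<close> of \<open>concave_levels\<close> at
        \<open>q / \<alpha>\<close> and \<open>r / \<alpha>\<close>.\<close>
      have \<alpha>qr: "\<alpha> \<le> \<mu> a * q" "\<alpha> \<le> \<mu> a * r"
        using \<mu>_a by (simp_all add: order_trans[OF \<alpha>(2)])
      have "S q \<alpha> \<le> level (\<alpha> / q) + \<epsilon>" "S r \<alpha> \<le> level (\<alpha> / r) + \<epsilon>"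
        using upper[OF q \<alpha>(1)] upper[OF r \<alpha>(1)] level_sub_1_le[OF q \<alpha>(1)] level_sub_1_le[OF r \<alpha>(1)] le
        by auto
      then have "\<phi> * S q \<alpha> + (1 - \<phi>) * S r \<alpha>
          \<le> \<phi> * (level (\<alpha> / q) + \<epsilon>) + (1 - \<phi>) * (level (\<alpha> / r) + \<epsilon>)"
        using \<phi> by (intro add_mono mult_left_mono) auto
      also have "\<dots> = \<phi> * level (1 / (q / \<alpha>)) + (1 - \<phi>) * level (1 / (r / \<alpha>)) + \<epsilon>"
        by (simp add: algebra_simps)
      also have "\<dots> \<le> level (1 / (\<phi> * (q / \<alpha>) + (1 - \<phi>) * (r / \<alpha>))) + \<epsilon>"
        using q r \<alpha>(1) \<alpha>qr \<phi> by (intro add_right_mono concave_levels conv) (simp_all add: pos_divide_le_eq)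
      also have "1 / (\<phi> * (q / \<alpha>) + (1 - \<phi>) * (r / \<alpha>)) = \<alpha> / p"
        by (simp add: p add_divide_distrib[symmetric])
      also have "level (\<alpha> / p) \<le> S p \<alpha>" using P \<alpha> by (intro lower) auto
      finally show ?thesis by simp
    qed
    then show "\<exists>P. \<forall>q>0. \<forall>r>0. \<forall>\<phi>\<in>{0..1}. \<forall>p \<alpha>. p = \<phi> * q + (1 - \<phi>) * r \<longrightarrow> P \<le> p \<longrightarrow>
        1 < \<alpha> \<longrightarrow> \<alpha> \<le> \<mu> a * min q r \<longrightarrow> \<phi> * S q \<alpha> + (1 - \<phi>) * S r \<alpha> \<le> S p \<alpha> + \<epsilon>"
      by blast
  qed
next
  assume conc: "approximately_concave (\<mu> a) S"
  show "convex_on {\<sigma>\<in>{a..1}. 0 < \<mu> \<sigma>} (\<lambda>\<sigma>. 1 / \<mu> \<sigma>)"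
  proof (rule convex_onI)
    show "convex {\<sigma>\<in>{a..1}. 0 < \<mu> \<sigma>}"
      unfolding is_interval_convex_1[symmetric] is_interval_1
    proof (intro ballI allI impI)
      fix u v x
      assume "u \<in> {\<sigma>\<in>{a..1}. 0 < \<mu> \<sigma>}" "v \<in> {\<sigma>\<in>{a..1}. 0 < \<mu> \<sigma>}" "u \<le> x \<and> x \<le> v"
      then show "x \<in> {\<sigma>\<in>{a..1}. 0 < \<mu> \<sigma>}" using \<mu>_antimono[of x v] by auto
    qed
  next
    fix t \<sigma> \<tau> :: real
    assume t: "0 < t" "t < 1"
      and "\<sigma> \<in> {\<sigma>\<in>{a..1}. 0 < \<mu> \<sigma>}" "\<tau> \<in> {\<sigma>\<in>{a..1}. 0 < \<mu> \<sigma>}"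
    then have \<sigma>: "\<sigma> \<in> {a..1}" "0 < \<mu> \<sigma>" and \<tau>: "\<tau> \<in> {a..1}" "0 < \<mu> \<tau>" by auto
    define \<phi> where "\<phi> = 1 - t"
    have \<phi>: "0 < \<phi>" "\<phi> < 1" using t by (auto simp: \<phi>_def)
    \<comment> \<open>The goal is \<open>1 / \<mu> \<rho> \<le> z\<close>. It follows from
      \<open>\<rho> \<le> level (1 / z)\<close> by \<open>le_\<mu>I\<close>, which also asks for
      \<open>1 / z \<le> \<mu> a\<close>.\<close>
    define z where "z = \<phi> * (1 / \<mu> \<sigma>) + (1 - \<phi>) * (1 / \<mu> \<tau>)"
    define \<rho> where "\<rho> = \<phi> * \<sigma> + (1 - \<phi>) * \<tau>"
    have z: "0 < z" using \<phi> \<sigma> \<tau> by (simp add: z_def add_pos_pos)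
    have \<mu>_le: "\<mu> \<sigma> \<le> \<mu> a" "\<mu> \<tau> \<le> \<mu> a"
      using \<mu>_antimono[of a] \<sigma> \<tau> a_less_1 by auto
    have "\<phi> * (1 / \<mu> a) + (1 - \<phi>) * (1 / \<mu> a) \<le> z"
      unfolding z_def using \<phi> \<sigma> \<tau> \<mu>_le \<mu>_a by (intro add_mono mult_left_mono) (simp_all add: frac_le)
    then have "1 / \<mu> a \<le> z" by (simp flip: add_divide_distrib)
    then have z': "1 / z \<le> \<mu> a" using z \<mu>_a by (simp add: pos_divide_le_eq mult.commute)
    have \<rho>: "\<rho> \<in> {a..1}"
    proof -
      have "\<phi> * a + (1 - \<phi>) * a \<le> \<rho>" "\<rho> \<le> \<phi> * 1 + (1 - \<phi>) * 1"
        unfolding \<rho>_def using \<phi> \<sigma> \<tau> by (intro add_mono mult_left_mono; simp)+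
      then show ?thesis by (simp flip: distrib_right)
    qed
    have "\<rho> \<le> level (1 / z)"
    proof (rule field_le_epsilon)
      fix e :: real assume "0 < e"
      obtain P where P: "\<forall>q>0. \<forall>r>0. \<forall>\<phi>\<in>{0..1}. \<forall>p \<alpha>. p = \<phi> * q + (1 - \<phi>) * r \<longrightarrow> P \<le> p \<longrightarrow>
          1 < \<alpha> \<longrightarrow> \<alpha> \<le> \<mu> a * min q r \<longrightarrow> \<phi> * S q \<alpha> + (1 - \<phi>) * S r \<alpha> \<le> S p \<alpha> + e / 2"
        using conc[unfolded approximately_concave_def, THEN spec, THEN mp, OF half_gt_zero[OF \<open>0 < e\<close>]] ..
      \<comment> \<open>In turn, the entries ensure \<open>1 < \<alpha>\<close>,
        \<open>1 \<le> ?q\<close>, \<open>1 \<le> ?r\<close>, \<open>P \<le> \<alpha> * z\<close>,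
        and a gap \<open>(1 - a) / \<alpha>\<close> of at most \<open>e / 2\<close>.\<close>
      define \<alpha> where "\<alpha> = Max {2, \<mu> \<sigma>, \<mu> \<tau>, P / z, 2 * (1 - a) / e}"
      have \<alpha>: "2 \<le> \<alpha>" "\<mu> \<sigma> \<le> \<alpha>" "\<mu> \<tau> \<le> \<alpha>" "P / z \<le> \<alpha>" "2 * (1 - a) / e \<le> \<alpha>"
        by (auto simp: \<alpha>_def)
      \<comment> \<open>With \<open>\<alpha> / ?q = \<mu> \<sigma>\<close> the lower bound gives
        \<open>\<sigma> \<le> level (\<mu> \<sigma>) \<le> S ?q \<alpha>\<close>, likewise for
        \<open>\<tau>\<close>, and the combination of \<open>?q\<close> and \<open>?r\<close> is
        exactly \<open>\<alpha> * z\<close>.\<close>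
      let ?q = "\<alpha> / \<mu> \<sigma>" and ?r = "\<alpha> / \<mu> \<tau>"
      have qr: "1 \<le> ?q" "1 \<le> ?r" using \<alpha> \<sigma> \<tau> by auto
      have pz: "\<alpha> * z = \<phi> * ?q + (1 - \<phi>) * ?r" by (simp add: z_def algebra_simps)
      have "\<alpha> \<le> \<mu> a * min ?q ?r"
        using \<mu>_le \<alpha>(1) \<sigma>(2) \<tau>(2) by (simp add: min_def pos_le_divide_eq mult.commute)
      then have *: "\<phi> * S ?q \<alpha> + (1 - \<phi>) * S ?r \<alpha> \<le> S (\<alpha> * z) \<alpha> + e / 2"
      proof (intro P[rule_format])
        show "P \<le> \<alpha> * z" using \<alpha>(4) z by (simp add: pos_divide_le_eq)
      qed (use \<alpha>(1) \<phi> qr pz in auto)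
      have "\<sigma> \<le> S ?q \<alpha>" "\<tau> \<le> S ?r \<alpha>"
        using lower[OF qr(1), of \<alpha>] lower[OF qr(2), of \<alpha>] \<alpha>(1) le_levelI[OF \<sigma> order_refl]
          le_levelI[OF \<tau> order_refl] by simp_all
      then have "\<rho> \<le> \<phi> * S ?q \<alpha> + (1 - \<phi>) * S ?r \<alpha>"
        unfolding \<rho>_def using \<phi> by (intro add_mono mult_left_mono) auto
      also note *
      also have "S (\<alpha> * z) \<alpha> \<le> level (\<alpha> / (\<alpha> * z)) + (1 - a) / \<alpha>"
        using upper[of "\<alpha> * z" \<alpha>] level_sub_1_le[of "\<alpha> * z" \<alpha>] z \<alpha>(1) by simp
      also have "\<alpha> / (\<alpha> * z) = 1 / z" using \<alpha> by simp
      also have "(1 - a) / \<alpha> \<le> e / 2"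
      proof -
        have "2 * (1 - a) \<le> \<alpha> * e" using \<alpha>(5) \<open>0 < e\<close> by (simp only: pos_divide_le_eq)
        then have "1 - a \<le> e / 2 * \<alpha>" by (simp add: mult.commute)
        then show ?thesis using \<alpha>(1) by (simp only: pos_divide_le_eq)
      qed
      finally show "\<rho> \<le> level (1 / z) + e" by simp
    qed
    have "1 / z \<le> \<mu> \<rho>" using le_\<mu>I[OF \<rho> less_imp_le[OF zero_less_divide_1_iff[THEN iffD2, OF z]] \<open>\<rho> \<le> level (1 / z)\<close> z'] .
    moreover from this have "0 < \<mu> \<rho>" using z by (metis less_le_trans zero_less_divide_1_iff)
    ultimately have "1 / \<mu> \<rho> \<le> z" using z by (metis pos_divide_le_eq mult.commute)
    then show "1 / \<mu> ((1 - t) *\<^sub>R \<sigma> + t *\<^sub>R \<tau>) \<le> (1 - t) * (1 / \<mu> \<sigma>) + t * (1 / \<mu> \<tau>)"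
      by (simp only: \<rho>_def z_def \<phi>_def real_scaleR_def diff_diff_eq2 diff_diff_eq) simp
  qed
qed

end

subsection \<open>The Gaussian kernel\<close>

text \<open>On horizontal sides at distance \<open>t / 2\<close> from \<open>s\<close> the Gaussian
  absorbs every power of \<open>t\<close>. The bound combines \<open>ln t \<le> t\<close> with the
  expansion of a square.\<close>

lemma powr_mult_exp_le:
  fixes t B :: real
  assumes "1 \<le> t"
  shows "t powr B * exp (- (t / 2)\<^sup>2) \<le> exp (B\<^sup>2)"
proof -
  have "0 \<le> ln t" "ln t \<le> t" using assms ln_le_minus_one[of t] by auto
  then have "B * ln t \<le> \<bar>B\<bar> * t"
    by (smt (verit) abs_ge_self abs_ge_zero mult_left_mono mult_right_mono)
  also have "\<dots> \<le> B\<^sup>2 + (t / 2)\<^sup>2"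
    using zero_le_power2[of "\<bar>B\<bar> - t / 2"] by (simp add: power2_diff)
  finally have "B * ln t + - (t / 2)\<^sup>2 \<le> B\<^sup>2" by simp
  then have "exp (B * ln t + - (t / 2)\<^sup>2) \<le> exp (B\<^sup>2)" by (simp only: exp_le_cancel_iff)
  then show ?thesis using assms by (simp only: exp_add powr_def) auto
qed

lemma powr_le_two_mult_powr:
  fixes t u m :: real
  assumes "0 \<le> u" "u \<le> 2 * t" "0 \<le> m"
  shows "u powr m \<le> 2 powr m * t powr m"
  using powr_mono2[of m u "2 * t"] assms by (simp add: powr_mult)

text \<open>Pointwise substitute for Hoelder's inequality: where \<open>x > y\<close>, the factor
  \<open>x powr (1 - p)\<close> is at most \<open>y powr (1 - p)\<close>.\<close>

lemma le_add_powr_mult_powr: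
  fixes x y p :: real
  assumes "0 \<le> x" "0 < y" "1 \<le> p"
  shows "x \<le> y + x powr p * y powr (1 - p)"
proof (cases "x \<le> y")
  case False
  have "x = x powr p * x powr (1 - p)" using False assms by (simp flip: powr_add)
  also have "\<dots> \<le> x powr p * y powr (1 - p)"
    using False assms by (intro mult_left_mono powr_mono2') auto
  finally show ?thesis using assms by simp
qed (use assms in \<open>simp add: add_increasing2\<close>)

text \<open>The term with \<open>L\<close> is the balancing factor of the interpolation; Cauchy's
  formula uses \<open>L = 0\<close>.\<close>

lemma norm_exp_gaussian:
  "norm (exp ((w - s)\<^sup>2 + of_real L * (w - s)))
    = exp ((Re w - Re s)\<^sup>2 - (Im w - Im s)\<^sup>2 + L * (Re w - Re s))"
  by (simp add: norm_exp_eq_Re Re_power2)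

text \<open>The majorant has the antiderivative \<open>arctan\<close>, so its integral over any
  interval is at most \<open>pi\<close>.\<close>

lemma exp_minus_power2_le: "exp (- x\<^sup>2) \<le> 1 / (1 + x\<^sup>2)" for x :: real
proof -
  have "1 + x\<^sup>2 \<le> exp (x\<^sup>2)" by (rule exp_ge_add_one_self)
  then show ?thesis
    using le_imp_inverse_le[of "1 + x\<^sup>2" "exp (x\<^sup>2)"]
    by (simp add: exp_minus inverse_eq_divide add_pos_nonneg)
qed

lemma has_integral_arctan_shift:
  fixes t t1 t2 :: real
  assumes "t1 \<le> t2"
  shows "((\<lambda>u. 1 / (1 + (u - t)\<^sup>2)) has_integral (arctan (t2 - t) - arctan (t1 - t))) {t1..t2}"
  by (rule fundamental_theorem_of_calculus[OF assms])
    (auto intro!: derivative_eq_intros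
      simp: has_real_derivative_iff_has_vector_derivative[symmetric] inverse_eq_divide)

text \<open>The integrand is split into a part bounded by the \<open>arctan\<close> density,
  contributing at most \<open>c * pi\<close>, and a remainder \<open>v\<close> that will carry the
  integral mean.\<close>

lemma norm_contour_integral_vertical_le:
  assumes "t1 < t2" and cont: "continuous_on {t1..t2} (\<lambda>u. g (Complex x u))"
    and v: "v integrable_on {t1..t2}" and "0 \<le> c"
    and le: "\<And>u. u \<in> {t1..t2} \<Longrightarrow> norm (g (Complex x u)) \<le> c * (1 / (1 + (u - t)\<^sup>2)) + v u"
  shows "norm (contour_integral (linepath (Complex x t1) (Complex x t2)) g)
    \<le> c * pi + integral {t1..t2} v"
proof -
  define A where "A = arctan (t2 - t) - arctan (t1 - t)"
  have A: "A \<le> pi"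
    using arctan_ubound[of "t2 - t"] arctan_lbound[of "t1 - t"] by (simp add: A_def)
  have hi: "((\<lambda>u. c * (1 / (1 + (u - t)\<^sup>2)) + v u) has_integral (c * A + integral {t1..t2} v)) {t1..t2}"
    unfolding A_def using assms(1)
    by (intro has_integral_add has_integral_mult_right has_integral_arctan_shift
        integrable_integral v) auto
  have "norm (contour_integral (linepath (Complex x t1) (Complex x t2)) g)
      = norm (integral {t1..t2} (\<lambda>u. g (Complex x u)))"
    using assms(1)
    by (subst contour_integral_linepath_same_Re[where c = x and a = t1 and b = t2])
      (auto simp: norm_mult)
  also have "\<dots> \<le> integral {t1..t2} (\<lambda>u. c * (1 / (1 + (u - t)\<^sup>2)) + v u)"
    using hi cont le
    by (intro Henstock_Kurzweil_Integration.integral_norm_bound_integral)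
      (auto intro: integrable_continuous_interval)
  also have "\<dots> = c * A + integral {t1..t2} v" using hi by (rule integral_unique)
  also have "\<dots> \<le> c * pi + integral {t1..t2} v" using A \<open>0 \<le> c\<close> by (simp add: mult_left_mono)
  finally show ?thesis .
qed

lemma nn_integral_powr_at_top_finite:
  fixes c :: real
  assumes "c < -1"
  shows "(\<integral>\<^sup>+t\<in>{1..}. ennreal (t powr c) \<partial>lborel) < \<infinity>"
proof -
  have "(\<integral>\<^sup>+t\<in>{1..}. ennreal (t powr c) \<partial>lborel) = ennreal (0 - 1 powr (c + 1) / (c + 1))"
  proof (rule nn_integral_FTC_atLeast[where F = "\<lambda>t. t powr (c + 1) / (c + 1)"])
    fix x :: real assume "1 \<le> x"
    then show "((\<lambda>t. t powr (c + 1) / (c + 1)) has_field_derivative x powr c) (at x)"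
      using assms by (auto intro!: derivative_eq_intros)
  next
    show "((\<lambda>t. t powr (c + 1) / (c + 1)) \<longlongrightarrow> 0) at_top"
      using assms by (intro tendsto_divide_zero tendsto_neg_powr filterlim_ident) auto
  qed auto
  then show ?thesis by simp
qed

subsection \<open>Growth on vertical lines\<close>

definition grows :: "(complex \<Rightarrow> complex) \<Rightarrow> real \<Rightarrow> real \<Rightarrow> bool" where
  "grows f \<sigma> m \<longleftrightarrow> (\<exists>C::real. \<forall>t\<ge>1. norm (f (Complex \<sigma> t)) \<le> C * t powr m)"

lemma growsE:
  assumes "grows f \<sigma> m"
  obtains C where "0 \<le> C" "\<And>t. 1 \<le> t \<Longrightarrow> norm (f (Complex \<sigma> t)) \<le> C * t powr m"
proof -
  obtain C where C: "\<And>t. 1 \<le> t \<Longrightarrow> norm (f (Complex \<sigma> t)) \<le> C * t powr m"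
    using assms by (auto simp: grows_def)
  moreover have "0 \<le> C" using order_trans[OF norm_ge_zero C[of 1]] by simp
  ultimately show ?thesis using that by blast
qed

lemma grows_mono:
  assumes "grows f \<sigma> m" "m \<le> m'"
  shows "grows f \<sigma> m'"
proof -
  obtain C where C: "0 \<le> C" "\<And>t. 1 \<le> t \<Longrightarrow> norm (f (Complex \<sigma> t)) \<le> C * t powr m"
    using growsE[OF assms(1)] by blast
  have "norm (f (Complex \<sigma> t)) \<le> C * t powr m'" if "1 \<le> t" for t
    using C(2)[OF that] mult_left_mono[OF powr_mono[OF assms(2) that] C(1)] by linarith
  then show ?thesis by (auto simp: grows_def)
qed

lemma order_fun_altdef: "order_fun f \<sigma> = Inf {m. 0 \<le> m \<and> grows f \<sigma> m}"
  by (simp add: order_fun_def grows_def)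

lemma order_fun_le: "0 \<le> m \<Longrightarrow> grows f \<sigma> m \<Longrightarrow> order_fun f \<sigma> \<le> m"
  unfolding order_fun_altdef by (intro cInf_lower) (auto intro: bdd_belowI[of _ 0])

locale strip_function =
  fixes a :: real and f :: "complex \<Rightarrow> complex"
  assumes a_less_1: "a < 1"
    and analytic: "f analytic_on half_strip a"
    and poly_bounded: "polynomially_bounded a f"
begin

lemma polynomial_bound:
  obtains A C where "0 \<le> A" "0 \<le> C"
    "\<And>\<sigma> t. \<sigma> \<in> {a..1} \<Longrightarrow> 1 \<le> t \<Longrightarrow> norm (f (Complex \<sigma> t)) \<le> C * t powr A"
proof -
  obtain A C where AC: "\<And>\<sigma> t. \<sigma> \<in> {a..1} \<Longrightarrow> 1 \<le> t \<Longrightarrow> norm (f (Complex \<sigma> t)) \<le> C * t powr A"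
    using poly_bounded unfolding polynomially_bounded_def by blast
  have "0 \<le> C" using order_trans[OF norm_ge_zero AC[of 1 1]] a_less_1 by simp
  moreover have "norm (f (Complex \<sigma> t)) \<le> C * t powr max A 0" if "\<sigma> \<in> {a..1}" "1 \<le> t" for \<sigma> t
    using AC[OF that] mult_left_mono[OF powr_mono[of A "max A 0" t] \<open>0 \<le> C\<close>] that by simp
  ultimately show ?thesis using that[of "max A 0" C] by auto
qed

text \<open>On the heights between 1 and 2 the polynomial bound gives a constant, and
  \<open>t powr m \<ge> 1\<close>. For \<open>2 \<le> t\<close> the rectangles starting at height
  \<open>t / 2\<close> stay in the half strip.\<close>

lemma growsI:
  assumes "\<sigma> \<in> {a..1}" "0 \<le> m" "\<And>t. 2 \<le> t \<Longrightarrow> norm (f (Complex \<sigma> t)) \<le> K * t powr m"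
  shows "grows f \<sigma> m"
proof -
  obtain A C where AC: "0 \<le> A" "0 \<le> C"
    "\<And>\<sigma> t. \<sigma> \<in> {a..1} \<Longrightarrow> 1 \<le> t \<Longrightarrow> norm (f (Complex \<sigma> t)) \<le> C * t powr A"
    using polynomial_bound by blast
  let ?K = "max K (C * 2 powr A)"
  have "norm (f (Complex \<sigma> t)) \<le> ?K * t powr m" if "1 \<le> t" for t
  proof (cases "2 \<le> t")
    case True
    then show ?thesis by (intro order_trans[OF assms(3)[OF True]] mult_right_mono) simp_all
  next
    case False
    have "norm (f (Complex \<sigma> t)) \<le> C * t powr A" using AC assms that by simp
    also have "\<dots> \<le> C * 2 powr A" using AC that False by (intro mult_left_mono powr_mono2) auto
    also have "\<dots> \<le> ?K" by simp
    also have "\<dots> \<le> ?K * t powr m"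
      using mult_left_mono[OF ge_one_powr_ge_zero[OF that assms(2)], of ?K] AC
      by (simp add: le_max_iff_disj)
    finally show ?thesis .
  qed
  then show ?thesis by (auto simp: grows_def)
qed

lemma exists_grows:
  assumes "\<sigma> \<in> {a..1}"
  shows "\<exists>m\<ge>0. grows f \<sigma> m"
  using polynomial_bound assms unfolding grows_def by metis

lemma order_fun_nonneg: "\<sigma> \<in> {a..1} \<Longrightarrow> 0 \<le> order_fun f \<sigma>"
  unfolding order_fun_altdef using exists_grows by (intro cInf_greatest) auto

lemma grows_above_order:
  assumes "\<sigma> \<in> {a..1}" "order_fun f \<sigma> < m"
  shows "grows f \<sigma> m"
proof -
  have "{m. 0 \<le> m \<and> grows f \<sigma> m} \<noteq> {}" using exists_grows[OF assms(1)] by auto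
  then obtain n where "grows f \<sigma> n" "n < m"
    using cInf_lessD[of "{m. 0 \<le> m \<and> grows f \<sigma> m}" m] assms(2) unfolding order_fun_altdef by auto
  then show ?thesis by (auto intro: grows_mono)
qed

section \<open>Phragmen-Lindelof convexity of the order function\<close>

lemma holomorphic_on_rectangle:
  assumes "a \<le> \<sigma>1" "\<sigma>2 \<le> 1" "1 \<le> t1"
  shows "f holomorphic_on cbox (Complex \<sigma>1 t1) (Complex \<sigma>2 t2)"
  by (rule holomorphic_on_subset[OF analytic_imp_holomorphic[OF analytic]])
    (use assms in \<open>auto simp: half_strip_def in_cbox_complex_iff\<close>)

text \<open>
  The factor \<open>exp (D * ln t * (w - s))\<close> with \<open>D = (m1 - m2) / (\<sigma>2 - \<sigma>1)\<close> balances the two vertical sides of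
  the rectangle, and the Gaussian factor makes the horizontal ones negligible.
\<close>

lemma grows_interpolation:
  assumes \<sigma>12: "\<sigma>1 \<in> {a..1}" "\<sigma>2 \<in> {a..1}" "\<sigma>1 < \<sigma>2"
    and m: "0 \<le> m1" "0 \<le> m2" "grows f \<sigma>1 m1" "grows f \<sigma>2 m2"
    and \<theta>: "0 < \<theta>" "\<theta> < 1"
  shows "grows f ((1 - \<theta>) * \<sigma>1 + \<theta> * \<sigma>2) ((1 - \<theta>) * m1 + \<theta> * m2)"
proof -
  obtain A C where AC: "0 \<le> A" "0 \<le> C"
    "\<And>\<sigma> t. \<sigma> \<in> {a..1} \<Longrightarrow> 1 \<le> t \<Longrightarrow> norm (f (Complex \<sigma> t)) \<le> C * t powr A"
    using polynomial_bound by blast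
  obtain C1 where C1: "0 \<le> C1" "\<And>t. 1 \<le> t \<Longrightarrow> norm (f (Complex \<sigma>1 t)) \<le> C1 * t powr m1"
    using growsE[OF m(3)] by blast
  obtain C2 where C2: "0 \<le> C2" "\<And>t. 1 \<le> t \<Longrightarrow> norm (f (Complex \<sigma>2 t)) \<le> C2 * t powr m2"
    using growsE[OF m(4)] by blast
  define W where "W = \<sigma>2 - \<sigma>1"
  have W: "0 < W" using \<sigma>12 by (simp add: W_def)
  define D where "D = (m1 - m2) / W"
  define \<sigma> where "\<sigma> = (1 - \<theta>) * \<sigma>1 + \<theta> * \<sigma>2"
  define n where "n = (1 - \<theta>) * m1 + \<theta> * m2"
  define E where "E = exp (W\<^sup>2)"
  \<comment> \<open>\<open>K1\<close>, \<open>K2\<close> and \<open>K3\<close> serve the left, the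
    right and the horizontal sides. The powers of 2 account for heights up to \<open>2 * t\<close>,
    and \<open>E\<close> bounds the Gaussian in the real direction.\<close>
  define K1 where "K1 = C1 * 2 powr m1 * E"
  define K2 where "K2 = C2 * 2 powr m2 * E"
  define K3 where "K3 = C * 2 powr A * E * exp ((A + \<bar>D\<bar> * W)\<^sup>2)"
  have K: "0 \<le> K1" "0 \<le> K2" "0 \<le> K3" using AC C1 C2 by (simp_all add: K1_def K2_def K3_def E_def)
  have \<sigma>_diff: "\<sigma> - \<sigma>1 = \<theta> * W" "\<sigma>2 - \<sigma> = (1 - \<theta>) * W"
    by (simp_all add: \<sigma>_def W_def algebra_simps)
  have \<sigma>: "\<sigma>1 < \<sigma>" "\<sigma> < \<sigma>2"
    using \<sigma>_diff \<theta> W by (smt (verit) mult_pos_pos)+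
  have DW: "D * W = m1 - m2" using W by (simp add: D_def)
  \<comment> \<open>The balancing factor has modulus \<open>t powr (D * (x - \<sigma>))\<close> at
    real part \<open>x\<close>, so it turns \<open>t powr m1\<close> on the left side and
    \<open>t powr m2\<close> on the right side into \<open>t powr n\<close>.\<close>
  have exponent1: "D * (\<sigma>1 - \<sigma>) = n - m1"
  proof -
    have "D * (\<sigma>1 - \<sigma>) = - (\<theta> * (D * W))" using \<sigma>_diff(1) by (simp add: algebra_simps)
    then show ?thesis by (simp add: DW n_def algebra_simps)
  qed
  have exponent2: "D * (\<sigma>2 - \<sigma>) = n - m2"
  proof -
    have "D * (\<sigma>2 - \<sigma>) = (1 - \<theta>) * (D * W)" unfolding \<sigma>_diff(2) by (rule mult.left_commute)
    then show ?thesis by (simp add: DW n_def algebra_simps)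
  qed
  have n: "0 \<le> n" using m \<theta> by (simp add: n_def)
  have "grows f \<sigma> n"
  proof (rule growsI)
    show "\<sigma> \<in> {a..1}" using \<sigma> \<sigma>12 by simp
    show "0 \<le> n" by (rule n)
    fix t :: real assume t: "2 \<le> t"
    define s where "s = Complex \<sigma> t"
    define F where "F w = f w * exp ((w - s)\<^sup>2 + of_real (D * ln t) * (w - s))" for w
    define S where "S = cbox (Complex \<sigma>1 (t / 2)) (Complex \<sigma>2 (3 * t / 2))"
    have holF: "F holomorphic_on S"
      unfolding F_def S_def using \<sigma>12 t
      by (intro holomorphic_intros holomorphic_on_rectangle) auto
    have "norm (F s) \<le> (K1 + K2 + K3) * t powr n"
    \<comment> \<open>The exponential factor is 1 at \<open>w = s\<close>, so a bound for
      \<open>F\<close> on the boundary bounds \<open>f s\<close>.\<close>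
    proof (rule maximum_modulus_frontier[of F S _ s])
      show "F holomorphic_on interior S" by (rule holomorphic_on_subset[OF holF interior_subset])
      show "continuous_on (closure S) F"
        using holomorphic_on_imp_continuous_on[OF holF] by (simp add: S_def)
      show "bounded S" by (simp add: S_def)
      show "s \<in> S" using \<sigma> t by (simp add: s_def S_def in_cbox_complex_iff)
    next
      fix w assume "w \<in> frontier S"
      then have w: "w \<in> S" "w \<notin> box (Complex \<sigma>1 (t / 2)) (Complex \<sigma>2 (3 * t / 2))"
        by (auto simp: S_def frontier_def interior_cbox closure_cbox)
      define x u where "x = Re w" and "u = Im w"
      have w_eq: "w = Complex x u" by (simp add: x_def u_def)
      have xu: "\<sigma>1 \<le> x" "x \<le> \<sigma>2" "t / 2 \<le> u" "u \<le> 3 * t / 2"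
        using w(1) by (auto simp: S_def in_cbox_complex_iff x_def u_def)
      have edge: "x = \<sigma>1 \<or> x = \<sigma>2 \<or> \<bar>u - t\<bar> = t / 2"
        using w(2) xu t by (auto simp: in_box_complex_iff x_def u_def)
      have u: "1 \<le> u" "0 \<le> u" "u \<le> 2 * t" using xu t by auto
      have x: "\<bar>x - \<sigma>\<bar> \<le> W" using xu \<sigma> by (auto simp: W_def)
      then have "(x - \<sigma>)\<^sup>2 \<le> W\<^sup>2" by (simp add: abs_le_square_iff[symmetric])
      then have E: "exp ((x - \<sigma>)\<^sup>2) \<le> E" by (simp add: E_def)
      have normF: "norm (F w) = norm (f (Complex x u)) * (exp ((x - \<sigma>)\<^sup>2) * exp (- (u - t)\<^sup>2) * t powr (D * (x - \<sigma>)))"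
        unfolding F_def norm_mult norm_exp_gaussian using t
        by (simp add: w_eq s_def powr_def exp_add[symmetric] algebra_simps)
      have side: "norm (F w) \<le> Cx * 2 powr mx * E * t powr n"
        if "0 \<le> Cx" "0 \<le> mx" "norm (f (Complex x u)) \<le> Cx * u powr mx" "D * (x - \<sigma>) = n - mx" for Cx mx
      proof -
        have f_le: "norm (f (Complex x u)) \<le> Cx * (2 powr mx * t powr mx)"
          using that u by (intro order_trans[OF that(3)] mult_left_mono powr_le_two_mult_powr)
        have "exp ((x - \<sigma>)\<^sup>2) * exp (- (u - t)\<^sup>2) \<le> E * 1"
          using E by (intro mult_mono) (simp_all add: E_def)
        then have exp_le: "exp ((x - \<sigma>)\<^sup>2) * exp (- (u - t)\<^sup>2) * t powr (D * (x - \<sigma>)) \<le> E * 1 * t powr (n - mx)"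
          unfolding that(4) by (rule mult_right_mono) simp
        have "norm (F w) \<le> Cx * (2 powr mx * t powr mx) * (E * 1 * t powr (n - mx))"
          unfolding normF using that(1) by (intro mult_mono[OF f_le exp_le]) simp_all
        also have "\<dots> = Cx * 2 powr mx * E * (t powr mx * t powr (n - mx))"
          by (simp only: mult_ac mult_1)
        also have "t powr mx * t powr (n - mx) = t powr n" by (simp flip: powr_add)
        finally show ?thesis .
      qed
      consider "x = \<sigma>1" | "x = \<sigma>2" | "\<bar>u - t\<bar> = t / 2" using edge by blast
      then have "norm (F w) \<le> K1 * t powr n \<or> norm (F w) \<le> K2 * t powr n \<or> norm (F w) \<le> K3 * t powr n"
      proof cases
        case 1
        then show ?thesis using side[of C1 m1] C1 m u exponent1 by (simp add: K1_def)
      next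
        case 2
        then show ?thesis using side[of C2 m2] C2 m u exponent2 by (simp add: K2_def)
      next
        case 3
        then have sq: "(u - t)\<^sup>2 = (t / 2)\<^sup>2" by (metis power2_abs)
        have "D * (x - \<sigma>) \<le> \<bar>D\<bar> * \<bar>x - \<sigma>\<bar>" by (simp flip: abs_mult)
        also have "\<dots> \<le> \<bar>D\<bar> * W" using x by (intro mult_left_mono) simp_all
        finally have "t powr (D * (x - \<sigma>)) \<le> t powr (\<bar>D\<bar> * W)" using t by simp
        moreover have "exp ((x - \<sigma>)\<^sup>2) * exp (- (t / 2)\<^sup>2) \<le> E * exp (- (t / 2)\<^sup>2)"
          using E by (rule mult_right_mono) simp
        ultimately have exp_le: "exp ((x - \<sigma>)\<^sup>2) * exp (- (t / 2)\<^sup>2) * t powr (D * (x - \<sigma>))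
            \<le> E * exp (- (t / 2)\<^sup>2) * t powr (\<bar>D\<bar> * W)"
          by (intro mult_mono) (simp_all add: E_def)
        have f_le: "norm (f (Complex x u)) \<le> C * (2 powr A * t powr A)"
          using AC(1,2) u \<sigma>12 xu
          by (intro order_trans[OF AC(3)] mult_left_mono powr_le_two_mult_powr) simp_all
        have "norm (F w) \<le> C * (2 powr A * t powr A) * (E * exp (- (t / 2)\<^sup>2) * t powr (\<bar>D\<bar> * W))"
          unfolding normF sq using AC(2) by (intro mult_mono[OF f_le exp_le]) simp_all
        also have "\<dots> = C * 2 powr A * E * (t powr (A + \<bar>D\<bar> * W) * exp (- (t / 2)\<^sup>2))"
          by (simp add: powr_add)
        also have "\<dots> \<le> C * 2 powr A * E * exp ((A + \<bar>D\<bar> * W)\<^sup>2)"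
          using AC t by (intro mult_left_mono powr_mult_exp_le) (auto simp: E_def)
        also have "\<dots> \<le> K3 * t powr n"
          using mult_left_mono[OF ge_one_powr_ge_zero[of t n] K(3)] t n by (simp add: K3_def)
        finally show ?thesis by simp
      qed
      moreover have "Ki * t powr n \<le> (K1 + K2 + K3) * t powr n" if "Ki \<in> {K1, K2, K3}" for Ki
        using that K by (intro mult_right_mono) auto
      ultimately show "norm (F w) \<le> (K1 + K2 + K3) * t powr n"
        by (meson insertI1 insertI2 order_trans)
    qed
    then show "norm (f (Complex \<sigma> t)) \<le> (K1 + K2 + K3) * t powr n" by (simp add: F_def s_def)
  qed
  then show ?thesis by (simp add: \<sigma>_def n_def)
qed

text \<open>Interpolation assumes \<open>\<sigma>1 < \<sigma>2\<close>; the reverse order follows by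
  exchanging the weights.\<close>

lemma convex_on_order_fun: "convex_on {a..1} (order_fun f)"
proof (rule convex_onI)
  have less: "order_fun f ((1 - \<theta>) * \<sigma>1 + \<theta> * \<sigma>2) \<le> (1 - \<theta>) * order_fun f \<sigma>1 + \<theta> * order_fun f \<sigma>2"
    if \<theta>: "0 < \<theta>" "\<theta> < 1" and \<sigma>: "\<sigma>1 \<in> {a..1}" "\<sigma>2 \<in> {a..1}" "\<sigma>1 < \<sigma>2" for \<theta> \<sigma>1 \<sigma>2
  proof (rule field_le_epsilon)
    fix e :: real assume "0 < e"
    \<comment> \<open>The order is an infimum and may fail to be an admissible exponent; any larger
      exponent is one.\<close>
    let ?m1 = "order_fun f \<sigma>1 + e" and ?m2 = "order_fun f \<sigma>2 + e"
    have "0 \<le> ?m1" "0 \<le> ?m2" using order_fun_nonneg \<sigma> \<open>0 < e\<close> by (simp_all add: add_nonneg_nonneg)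
    moreover have "grows f \<sigma>1 ?m1" "grows f \<sigma>2 ?m2"
      using grows_above_order \<sigma> \<open>0 < e\<close> by simp_all
    ultimately have "order_fun f ((1 - \<theta>) * \<sigma>1 + \<theta> * \<sigma>2) \<le> (1 - \<theta>) * ?m1 + \<theta> * ?m2"
      using \<theta> \<sigma> by (intro order_fun_le grows_interpolation) auto
    then show "order_fun f ((1 - \<theta>) * \<sigma>1 + \<theta> * \<sigma>2)
        \<le> (1 - \<theta>) * order_fun f \<sigma>1 + \<theta> * order_fun f \<sigma>2 + e"
      by (simp add: algebra_simps)
  qed
  fix t x y :: real
  assume t: "0 < t" "t < 1" and xy: "x \<in> {a..1}" "y \<in> {a..1}"
  consider "x < y" | "y < x" | "x = y" by linarith
  then show "order_fun f ((1 - t) *\<^sub>R x + t *\<^sub>R y) \<le> (1 - t) * order_fun f x + t * order_fun f y"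
  proof cases
    case 1
    then show ?thesis using less[of t x y] t xy by simp
  next
    case 2
    then show ?thesis using less[of "1 - t" y x] t xy by (simp add: add.commute)
  next
    case 3
    then show ?thesis by (simp flip: distrib_right)
  qed
qed simp

subsection \<open>Integral means on vertical lines\<close>

lemma continuous_on_vertical:
  assumes "\<sigma> \<in> {a..1}" "1 \<le> t1"
  shows "continuous_on {t1..t2} (\<lambda>u. f (Complex \<sigma> u))"
proof -
  have "continuous_on (half_strip a) f"
    by (intro holomorphic_on_imp_continuous_on analytic_imp_holomorphic analytic)
  moreover have "continuous_on {t1..t2} (Complex \<sigma>)"
    unfolding Complex_eq[abs_def] by (intro continuous_intros)
  moreover have "Complex \<sigma> ` {t1..t2} \<subseteq> half_strip a"
    using assms by (auto simp: half_strip_def)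
  ultimately show ?thesis by (rule continuous_on_compose2)
qed

text \<open>For \<open>u\<close> up to \<open>3 * t / 2\<close> the weight
  \<open>1 / u powr \<alpha>\<close> is at least \<open>1 / (2 * t) powr \<alpha>\<close>, so
  removing it costs a factor \<open>2 powr \<alpha> * t powr \<alpha>\<close>.\<close>

lemma Lp_integral_local:
  assumes fin: "Lp_integral f p \<alpha> \<sigma> < \<infinity>" and \<sigma>: "\<sigma> \<in> {a..1}" and "0 < p" "0 \<le> \<alpha>"
  obtains J where "0 \<le> J"
    "\<And>t. 2 \<le> t \<Longrightarrow> integral {t / 2..3 * t / 2} (\<lambda>u. norm (f (Complex \<sigma> u)) powr p) \<le> J * t powr \<alpha>"
proof
  define I where "I = enn2real (Lp_integral f p \<alpha> \<sigma>)"
  have I: "Lp_integral f p \<alpha> \<sigma> = ennreal I" "0 \<le> I"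
    using fin by (auto simp: I_def less_top)
  show "0 \<le> 2 powr \<alpha> * I" using I by simp
  fix t :: real assume t: "2 \<le> t"
  let ?T = "{t / 2..3 * t / 2}"
  let ?h = "\<lambda>u. norm (f (Complex \<sigma> u)) powr p"
  have conth: "continuous_on ?T ?h"
    using t \<sigma> assms by (intro continuous_on_powr' continuous_on_norm continuous_on_vertical continuous_on_const) auto
  have contq: "continuous_on ?T (\<lambda>u. ?h u / u powr \<alpha>)"
    using t by (intro continuous_on_divide conth continuous_intros) auto
  have int: "(\<lambda>u. ?h u / u powr \<alpha>) integrable_on ?T"
    by (rule integrable_continuous_interval[OF contq])
  have "ennreal (integral ?T (\<lambda>u. ?h u / u powr \<alpha>))
      = (\<integral>\<^sup>+u. ennreal (?h u / u powr \<alpha>) * indicator ?T u \<partial>lborel)"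
    by (rule nn_integral_has_integral_lebesgue'[symmetric, OF _ integrable_integral[OF int]]) simp
  also have "\<dots> \<le> Lp_integral f p \<alpha> \<sigma>"
    unfolding Lp_integral_def using t
    by (intro nn_integral_mono) (auto simp: indicator_def)
  finally have le_I: "integral ?T (\<lambda>u. ?h u / u powr \<alpha>) \<le> I"
    using I by simp
  have "integral ?T ?h \<le> integral ?T (\<lambda>u. 2 powr \<alpha> * t powr \<alpha> * (?h u / u powr \<alpha>))"
  proof (rule integral_le)
    show "?h integrable_on ?T" by (rule integrable_continuous_interval[OF conth])
    show "(\<lambda>u. 2 powr \<alpha> * t powr \<alpha> * (?h u / u powr \<alpha>)) integrable_on ?T"
      using int by (rule integrable_on_mult_right)
    fix u assume u: "u \<in> ?T"
    have "?h u = u powr \<alpha> * (?h u / u powr \<alpha>)" using u t by simp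
    also have "\<dots> \<le> 2 powr \<alpha> * t powr \<alpha> * (?h u / u powr \<alpha>)"
      using u t assms by (intro mult_right_mono powr_le_two_mult_powr) auto
    finally show "?h u \<le> 2 powr \<alpha> * t powr \<alpha> * (?h u / u powr \<alpha>)" .
  qed
  also have "\<dots> = 2 powr \<alpha> * t powr \<alpha> * integral ?T (\<lambda>u. ?h u / u powr \<alpha>)"
    by (rule integral_mult_right)
  also have "\<dots> \<le> 2 powr \<alpha> * t powr \<alpha> * I" using le_I by (intro mult_left_mono) auto
  finally show "integral ?T ?h \<le> 2 powr \<alpha> * I * t powr \<alpha>" by (simp add: mult_ac)
qed

section \<open>From integral means to pointwise growth by Cauchy's formula\<close>

lemma Cauchy_rectangle:
  assumes holG: "G holomorphic_on cbox (Complex x1 t1) (Complex x2 t2)"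
    and s: "s \<in> box (Complex x1 t1) (Complex x2 t2)"
  defines "g \<equiv> \<lambda>w. G w / (w - s)"
  shows "2 * pi * \<i> * G s
    = contour_integral (linepath (Complex x1 t1) (Complex x2 t1)) g
      + contour_integral (linepath (Complex x2 t1) (Complex x2 t2)) g
      + contour_integral (linepath (Complex x2 t2) (Complex x1 t2)) g
      - contour_integral (linepath (Complex x1 t1) (Complex x1 t2)) g"
proof -
  define S where "S = cbox (Complex x1 t1) (Complex x2 t2)"
  let ?R = "rectpath (Complex x1 t1) (Complex x2 t2)"
  have less: "x1 < x2" "t1 < t2" using s by (auto simp: in_box_complex_iff)
  have img: "path_image ?R \<subseteq> S - {s}"
    using less s by (subst path_image_rectpath_cbox_minus_box) (auto simp: S_def)
  have "(g has_contour_integral (2 * pi * \<i> * winding_number ?R s * G s)) ?R"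
    unfolding g_def using holG s img
    by (intro Cauchy_integral_formula_convex_simple[where S = S]) (auto simp: S_def interior_cbox)
  then have has: "(g has_contour_integral (2 * pi * \<i> * G s)) ?R"
    using s by (simp add: winding_number_rectpath)
  have contg: "continuous_on (S - {s}) g"
    unfolding g_def using holomorphic_on_imp_continuous_on[OF holG]
    by (intro continuous_intros) (auto simp: S_def elim: continuous_on_subset)
  have R: "?R = linepath (Complex x1 t1) (Complex x2 t1) +++ linepath (Complex x2 t1) (Complex x2 t2)
      +++ linepath (Complex x2 t2) (Complex x1 t2) +++ linepath (Complex x1 t2) (Complex x1 t1)"
    by (simp add: rectpath_def Let_def)
  have segs: "closed_segment (Complex x1 t1) (Complex x2 t1) \<subseteq> S - {s}"
    "closed_segment (Complex x2 t1) (Complex x2 t2) \<subseteq> S - {s}"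
    "closed_segment (Complex x2 t2) (Complex x1 t2) \<subseteq> S - {s}"
    "closed_segment (Complex x1 t2) (Complex x1 t1) \<subseteq> S - {s}"
    using img unfolding R by (auto simp: path_image_join)
  have int: "g contour_integrable_on linepath b c" if "closed_segment b c \<subseteq> S - {s}" for b c
    by (rule contour_integrable_continuous_linepath[OF continuous_on_subset[OF contg that]])
  have "2 * pi * \<i> * G s = contour_integral ?R g"
    using has by (simp add: contour_integral_unique)
  also have "\<dots> = contour_integral (linepath (Complex x1 t1) (Complex x2 t1)) g
      + contour_integral (linepath (Complex x2 t1) (Complex x2 t2)) g
      + contour_integral (linepath (Complex x2 t2) (Complex x1 t2)) g
      + contour_integral (linepath (Complex x1 t2) (Complex x1 t1)) g"
    unfolding R using int[OF segs(1)] int[OF segs(2)] int[OF segs(3)] int[OF segs(4)] by simp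
  \<comment> \<open>The left side is reversed to run upwards, as in
    \<open>norm_contour_integral_vertical_le\<close>.\<close>
  also have "contour_integral (linepath (Complex x1 t2) (Complex x1 t1)) g
      = - contour_integral (linepath (Complex x1 t1) (Complex x1 t2)) g"
    using int[OF segs(4)] contour_integral_reverse_linepath[of "Complex x1 t1" "Complex x1 t2" g]
      continuous_on_subset[OF contg segs(4)] by (simp add: closed_segment_commute)
  finally show ?thesis by simp
qed

text \<open>On the left side \<open>f\<close> is controlled only in the mean;
  \<open>le_add_powr_mult_powr\<close> with threshold \<open>t powr (\<alpha> / p)\<close> converts
  this into a bound, using \<open>1 \<le> p\<close>. The strict inequalities for
  \<open>\<sigma>\<close> keep the pole of the kernel off the vertical sides.\<close>

lemma grows_if_Lp_integral_finite:
  assumes fin: "Lp_integral f p \<alpha> \<sigma>1 < \<infinity>" and p: "1 \<le> p" and \<alpha>: "0 < \<alpha>"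
    and \<sigma>1: "a \<le> \<sigma>1" and \<sigma>: "\<sigma>1 < \<sigma>" "\<sigma> < 1" and order_1: "order_fun f 1 = 0"
  shows "grows f \<sigma> (\<alpha> / p)"
proof -
  define m where "m = \<alpha> / p"
  have m: "0 < m" using p \<alpha> by (simp add: m_def)
  obtain A C where AC: "0 \<le> A" "0 \<le> C"
    "\<And>\<sigma> t. \<sigma> \<in> {a..1} \<Longrightarrow> 1 \<le> t \<Longrightarrow> norm (f (Complex \<sigma> t)) \<le> C * t powr A"
    using polynomial_bound by blast
  \<comment> \<open>Order 0 on the right side admits every positive exponent, in particular
    \<open>m\<close>.\<close>
  have "grows f 1 m" using order_1 m a_less_1 by (intro grows_above_order) auto
  then obtain C2 where C2: "0 \<le> C2" "\<And>t. 1 \<le> t \<Longrightarrow> norm (f (Complex 1 t)) \<le> C2 * t powr m"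
    using growsE by blast
  obtain J where J: "0 \<le> J"
    "\<And>t. 2 \<le> t \<Longrightarrow> integral {t / 2..3 * t / 2} (\<lambda>u. norm (f (Complex \<sigma>1 u)) powr p) \<le> J * t powr \<alpha>"
    using Lp_integral_local[OF fin] \<sigma>1 \<sigma> p \<alpha> by auto
  define W where "W = 1 - \<sigma>1"
  define E where "E = exp (W\<^sup>2)"
  have E: "0 < E" by (simp add: E_def)
  \<comment> \<open>The denominators in \<open>K1\<close> and \<open>K2\<close> are the distances
    from \<open>s\<close> to the vertical sides. No denominator occurs in \<open>K3\<close>, since
    the horizontal sides are at distance \<open>t / 2 \<ge> 1\<close>.\<close>
  define K1 where "K1 = E / (\<sigma> - \<sigma>1)"
  define K2 where "K2 = E / (1 - \<sigma>) * (C2 * 2 powr m)"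
  define K3 where "K3 = C * 2 powr A * E * exp (A\<^sup>2)"
  have K: "0 \<le> K1" "0 \<le> K2" "0 \<le> K3"
    using E \<sigma> AC C2 by (simp_all add: K1_def K2_def K3_def)
  show ?thesis
    unfolding m_def[symmetric]
  proof (rule growsI)
    show "\<sigma> \<in> {a..1}" "0 \<le> m" using \<sigma> \<sigma>1 m by auto
    fix t :: real assume t: "2 \<le> t"
    let ?T = "{t / 2..3 * t / 2}"
    define Y where "Y = t powr m"
    have Y: "1 \<le> Y" "0 < Y" "0 \<le> Y" using t m ge_one_powr_ge_zero[of t m] by (auto simp: Y_def)
    define s where "s = Complex \<sigma> t"
    \<comment> \<open>The vanishing term matches the form of \<open>norm_exp_gaussian\<close>. Again
      the exponential is 1 at \<open>s\<close>.\<close>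
    define G where "G w = f w * exp ((w - s)\<^sup>2 + of_real 0 * (w - s))" for w
    define g where "g w = G w / (w - s)" for w
    have holG: "G holomorphic_on cbox (Complex \<sigma>1 (t / 2)) (Complex 1 (3 * t / 2))"
      unfolding G_def using \<sigma>1 t
      by (intro holomorphic_intros holomorphic_on_rectangle) auto
    have norm_g: "norm (g (Complex x u))
        = norm (f (Complex x u)) * (exp ((x - \<sigma>)\<^sup>2) * exp (- (u - t)\<^sup>2)) / norm (Complex x u - s)" for x u
      unfolding g_def G_def norm_divide norm_mult norm_exp_gaussian
      by (simp add: s_def flip: exp_add)
    have E_bound: "exp ((x - \<sigma>)\<^sup>2) \<le> E" if "\<sigma>1 \<le> x" "x \<le> 1" for x
    proof -
      have "\<bar>x - \<sigma>\<bar> \<le> \<bar>W\<bar>" using that \<sigma> by (auto simp: W_def)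
      then have "(x - \<sigma>)\<^sup>2 \<le> W\<^sup>2" by (simp only: abs_le_square_iff)
      then show ?thesis by (simp add: E_def)
    qed
    have vertical_g: "norm (g (Complex x u)) \<le> E / \<bar>x - \<sigma>\<bar> * (norm (f (Complex x u)) * exp (- (u - t)\<^sup>2))"
      if "\<sigma>1 \<le> x" "x \<le> 1" "x \<noteq> \<sigma>" for x u
    proof -
      have "\<bar>x - \<sigma>\<bar> \<le> norm (Complex x u - s)"
        using abs_Re_le_cmod[of "Complex x u - s"] by (simp add: s_def)
      then have "norm (g (Complex x u))
          \<le> norm (f (Complex x u)) * (E * exp (- (u - t)\<^sup>2)) / \<bar>x - \<sigma>\<bar>"
        unfolding norm_g using E_bound[OF that(1,2)] that(3)
        by (intro frac_le mult_left_mono mult_right_mono) (auto simp: E_def)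
      then show ?thesis by (simp add: mult_ac)
    qed
    have cont_g: "continuous_on ?T (\<lambda>u. g (Complex x u))" if "x \<in> {\<sigma>1..1}" "x \<noteq> \<sigma>" for x
      unfolding g_def G_def using that \<sigma>1 t
      by (intro continuous_intros continuous_on_vertical)
        (auto simp: s_def complex_eq_iff Complex_eq intro!: continuous_intros)
    have horizontal: "norm (contour_integral (linepath (Complex x1 u) (Complex x2 u)) g) \<le> K3 * norm (Complex x2 u - Complex x1 u)"
      if x: "x1 \<in> {\<sigma>1..1}" "x2 \<in> {\<sigma>1..1}" and u: "\<bar>u - t\<bar> = t / 2" for x1 x2 u
    proof -
      have in_segment: "w = Complex (Re w) u \<and> Re w \<in> {\<sigma>1..1}"
        if "w \<in> closed_segment (Complex x1 u) (Complex x2 u)" for w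
        using that x by (auto simp: closed_segment_same_Im closed_segment_eq_real_ivl complex_eq_iff split: if_splits)
      have u': "1 \<le> u" "0 \<le> u" "u \<le> 2 * t" "u \<noteq> t" "t / 2 \<le> u" "u \<le> 3 * t / 2"
        using u t by linarith+
      have sq: "(u - t)\<^sup>2 = (t / 2)\<^sup>2" using u by (metis power2_abs)
      have "continuous_on (closed_segment (Complex x1 u) (Complex x2 u)) g"
        unfolding g_def
      proof (intro continuous_on_divide continuous_intros)
        have "closed_segment (Complex x1 u) (Complex x2 u) \<subseteq> cbox (Complex \<sigma>1 (t / 2)) (Complex 1 (3 * t / 2))"
          using x u' by (intro closed_segment_subset) (auto simp: in_cbox_complex_iff)
        then show "continuous_on (closed_segment (Complex x1 u) (Complex x2 u)) G"
          by (rule continuous_on_subset[OF holomorphic_on_imp_continuous_on[OF holG]])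
        show "\<forall>w\<in>closed_segment (Complex x1 u) (Complex x2 u). w - s \<noteq> 0"
          using in_segment u' by (force simp: s_def)
      qed
      then have "g contour_integrable_on linepath (Complex x1 u) (Complex x2 u)"
        by (rule contour_integrable_continuous_linepath)
      moreover have "norm (g w) \<le> K3" if "w \<in> closed_segment (Complex x1 u) (Complex x2 u)" for w
      proof -
        obtain y where w: "w = Complex y u" "y \<in> {\<sigma>1..1}" using in_segment[OF \<open>w \<in> _\<close>] by blast
        have "1 \<le> norm (Complex y u - s)"
          using abs_Im_le_cmod[of "Complex y u - s"] u t by (simp add: s_def)
        then have "norm (g w) \<le> norm (f (Complex y u)) * (exp ((y - \<sigma>)\<^sup>2) * exp (- (t / 2)\<^sup>2)) / 1"
          unfolding w(1) norm_g sq by (intro frac_le) simp_all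
        also have "\<dots> \<le> C * (2 powr A * t powr A) * (E * exp (- (t / 2)\<^sup>2)) / 1"
        proof (intro divide_right_mono mult_mono)
          show "norm (f (Complex y u)) \<le> C * (2 powr A * t powr A)"
            using AC(1,2) u' \<sigma>1 w(2)
            by (intro order_trans[OF AC(3)] mult_left_mono powr_le_two_mult_powr) simp_all
          show "exp ((y - \<sigma>)\<^sup>2) \<le> E" using E_bound w(2) by simp
        qed (use AC E in simp_all)
        also have "\<dots> = C * 2 powr A * E * (t powr A * exp (- (t / 2)\<^sup>2))"
          by simp
        also have "\<dots> \<le> K3"
          unfolding K3_def using AC E t by (intro mult_left_mono powr_mult_exp_le) simp_all
        finally show ?thesis .
      qed
      ultimately show ?thesis
        using K(3) by (intro has_contour_integral_bound_linepath[OF has_contour_integral_integral])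
    qed
    have gauss: "exp (- (u - t)\<^sup>2) \<le> 1 / (1 + (u - t)\<^sup>2)" for u
      by (rule exp_minus_power2_le)
    let ?L = "\<lambda>x. contour_integral (linepath (Complex x (t / 2)) (Complex x (3 * t / 2))) g"
    have left: "norm (?L \<sigma>1) \<le> K1 * (pi + J) * Y"
    proof -
      define h where "h u = norm (f (Complex \<sigma>1 u)) powr p" for u
      define v where "v u = K1 * Y powr (1 - p) * h u" for u
      have inth: "h integrable_on ?T"
        unfolding h_def using t \<sigma> \<sigma>1 p
        by (intro integrable_continuous_interval continuous_on_powr' continuous_on_norm
            continuous_on_vertical continuous_on_const) auto
      have "norm (?L \<sigma>1) \<le> (K1 * Y) * pi + integral ?T v"
      proof (rule norm_contour_integral_vertical_le)
        show "v integrable_on ?T" unfolding v_def by (intro integrable_on_mult_right inth)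
        fix u assume "u \<in> ?T"
        let ?x = "norm (f (Complex \<sigma>1 u))" and ?e = "exp (- (u - t)\<^sup>2)"
        have "?x * ?e \<le> (Y + ?x powr p * Y powr (1 - p)) * ?e"
          using Y p by (intro mult_right_mono le_add_powr_mult_powr) auto
        also have "\<dots> = Y * ?e + ?x powr p * Y powr (1 - p) * ?e" by (rule distrib_right)
        also have "\<dots> \<le> Y * (1 / (1 + (u - t)\<^sup>2)) + ?x powr p * Y powr (1 - p) * 1"
          using Y by (intro add_mono mult_left_mono gauss) auto
        finally have "K1 * (?x * ?e) \<le> K1 * (Y * (1 / (1 + (u - t)\<^sup>2)) + ?x powr p * Y powr (1 - p))"
          using K by (intro mult_left_mono) simp_all
        moreover have "norm (g (Complex \<sigma>1 u)) \<le> K1 * (?x * ?e)"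
          using vertical_g[of \<sigma>1 u] \<sigma> by (simp add: K1_def)
        ultimately show "norm (g (Complex \<sigma>1 u)) \<le> K1 * Y * (1 / (1 + (u - t)\<^sup>2)) + v u"
          by (simp add: v_def h_def algebra_simps)
      qed (use t \<sigma> K Y cont_g in auto)
      also have "integral ?T v = K1 * Y powr (1 - p) * integral ?T h"
        unfolding v_def by (rule integral_mult_right)
      also have "\<dots> \<le> K1 * Y powr (1 - p) * (J * t powr \<alpha>)"
        using J(2)[OF t] K by (intro mult_left_mono) (auto simp: h_def[abs_def])
      \<comment> \<open>This identity dictates the choice of \<open>Y\<close>: both parts of the
        split are then of size \<open>Y\<close>.\<close>
      also have "t powr \<alpha> = Y powr p" using p by (simp add: Y_def m_def powr_powr)
      also have "K1 * Y powr (1 - p) * (J * Y powr p) = K1 * J * (Y powr (1 - p) * Y powr p)" by simp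
      also have "Y powr (1 - p) * Y powr p = Y" using Y by (simp flip: powr_add)
      finally show ?thesis by (simp add: algebra_simps)
    qed
    have right: "norm (?L 1) \<le> K2 * pi * Y"
    proof -
      have "norm (?L 1) \<le> (K2 * Y) * pi + integral ?T (\<lambda>_. 0)"
      proof (rule norm_contour_integral_vertical_le)
        fix u assume u: "u \<in> ?T"
        let ?x = "norm (f (Complex 1 u))" and ?e = "exp (- (u - t)\<^sup>2)"
        have "?x \<le> C2 * (2 powr m * t powr m)"
          using u t m C2(1) by (intro order_trans[OF C2(2)] mult_left_mono powr_le_two_mult_powr) auto
        then have "?x * ?e \<le> C2 * (2 powr m * Y) * (1 / (1 + (u - t)\<^sup>2))"
          unfolding Y_def using C2(1) by (intro mult_mono gauss) simp_all
        then have "E / (1 - \<sigma>) * (?x * ?e) \<le> E / (1 - \<sigma>) * (C2 * (2 powr m * Y) * (1 / (1 + (u - t)\<^sup>2)))"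
          using E \<sigma> by (intro mult_left_mono) simp_all
        moreover have "norm (g (Complex 1 u)) \<le> E / (1 - \<sigma>) * (?x * ?e)"
          using vertical_g[of 1 u] \<sigma> by simp
        ultimately show "norm (g (Complex 1 u)) \<le> K2 * Y * (1 / (1 + (u - t)\<^sup>2)) + 0"
          by (simp add: K2_def mult_ac)
      qed (use t \<sigma> K Y cont_g in auto)
      then show ?thesis by (simp add: mult_ac)
    qed
    let ?H = "\<lambda>x1 x2 u. contour_integral (linepath (Complex x1 u) (Complex x2 u)) g"
    have "2 * pi * \<i> * G s = ?H \<sigma>1 1 (t / 2) + ?L 1 + ?H 1 \<sigma>1 (3 * t / 2) - ?L \<sigma>1"
      unfolding g_def using \<sigma> t
      by (intro Cauchy_rectangle holG) (auto simp: s_def in_box_complex_iff)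
    then have "norm (2 * pi * \<i> * G s)
        \<le> norm (?H \<sigma>1 1 (t / 2)) + norm (?L 1) + norm (?H 1 \<sigma>1 (3 * t / 2)) + norm (?L \<sigma>1)"
      by (smt (verit) norm_triangle_ineq norm_triangle_ineq4)
    also have "\<dots> \<le> K3 * W * Y + K2 * pi * Y + K3 * W * Y + K1 * (pi + J) * Y"
    proof (intro add_mono left right)
      have "norm (?H \<sigma>1 1 (t / 2)) \<le> K3 * W"
        using horizontal[of \<sigma>1 1 "t / 2"] \<sigma> t by (simp add: W_def cmod_def)
      \<comment> \<open>The horizontal sides are bounded independently of \<open>t\<close>, and
        \<open>1 \<le> Y\<close>.\<close>
      also have "\<dots> \<le> K3 * W * Y"
        using mult_left_mono[of 1 Y "K3 * W"] K Y \<sigma> by (simp add: W_def)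
      finally show "norm (?H \<sigma>1 1 (t / 2)) \<le> K3 * W * Y" .
      have "norm (?H 1 \<sigma>1 (3 * t / 2)) \<le> K3 * W"
        using horizontal[of 1 \<sigma>1 "3 * t / 2"] \<sigma> t by (simp add: W_def cmod_def)
      also have "\<dots> \<le> K3 * W * Y"
        using mult_left_mono[of 1 Y "K3 * W"] K Y \<sigma> by (simp add: W_def)
      finally show "norm (?H 1 \<sigma>1 (3 * t / 2)) \<le> K3 * W * Y" .
    qed
    also have "\<dots> = (2 * K3 * W + K2 * pi + K1 * (pi + J)) * Y" by (simp add: algebra_simps)
    finally have "2 * pi * norm (f s) \<le> (2 * K3 * W + K2 * pi + K1 * (pi + J)) * Y"
      by (simp add: norm_mult G_def)
    moreover have "1 * norm (f s) \<le> 2 * pi * norm (f s)"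
      using pi_gt3 by (intro mult_right_mono) auto
    ultimately show "norm (f (Complex \<sigma> t)) \<le> (2 * K3 * W + K2 * pi + K1 * (pi + J)) * t powr m"
      by (simp add: s_def Y_def)
  qed
qed

text \<open>An exponent \<open>m\<close> strictly between the order and
  \<open>(\<alpha> - 1) / p\<close> bounds the integrand by a multiple of
  \<open>t powr (m * p - \<alpha>)\<close>, with \<open>m * p - \<alpha> < -1\<close>.\<close>

lemma Lp_integral_finite:
  assumes "\<sigma> \<in> {a..1}" "order_fun f \<sigma> < (\<alpha> - 1) / p" "0 < p"
  shows "Lp_integral f p \<alpha> \<sigma> < \<infinity>"
proof -
  obtain m where m: "order_fun f \<sigma> < m" "m < (\<alpha> - 1) / p" using dense[OF assms(2)] by blast
  then have mp: "m * p < \<alpha> - 1" using assms(3) by (simp add: pos_less_divide_eq)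
  obtain C where C: "0 \<le> C" "\<And>t. 1 \<le> t \<Longrightarrow> norm (f (Complex \<sigma> t)) \<le> C * t powr m"
    using growsE[OF grows_above_order[OF assms(1) m(1)]] by blast
  have "Lp_integral f p \<alpha> \<sigma> \<le> (\<integral>\<^sup>+t. ennreal (C powr p) * (ennreal (t powr (m * p - \<alpha>)) * indicator {1..} t) \<partial>lborel)"
    unfolding Lp_integral_def
  proof (intro nn_integral_mono)
    fix t :: real
    show "ennreal (norm (f (Complex \<sigma> t)) powr p / t powr \<alpha>) * indicator {1..} t
        \<le> ennreal (C powr p) * (ennreal (t powr (m * p - \<alpha>)) * indicator {1..} t)"
    proof (cases "1 \<le> t")
      case True
      have "norm (f (Complex \<sigma> t)) powr p / t powr \<alpha> \<le> (C * t powr m) powr p / t powr \<alpha>"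
        using C(2)[OF True] assms(3) by (intro divide_right_mono powr_mono2) auto
      also have "\<dots> = C powr p * t powr (m * p - \<alpha>)"
        using C(1) True by (simp add: powr_mult powr_powr powr_diff)
      finally show ?thesis using True by (simp add: ennreal_leI flip: ennreal_mult)
    qed simp
  qed
  also have "\<dots> = ennreal (C powr p) * (\<integral>\<^sup>+t\<in>{1..}. ennreal (t powr (m * p - \<alpha>)) \<partial>lborel)"
    by (rule nn_integral_cmult) measurable
  also have "\<dots> < \<infinity>"
    using nn_integral_powr_at_top_finite[of "m * p - \<alpha>"] mp by (simp add: ennreal_mult_less_top)
  finally show ?thesis .
qed

end

section \<open>Enclosure of the abscissae between two levels\<close>

locale strip_function_order_0 = strip_function +
  assumes order_1: "order_fun f 1 = 0"
begin

sublocale convex_order a "order_fun f"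
  by unfold_locales (use a_less_1 convex_on_order_fun order_fun_nonneg order_1 in auto)

lemma Lp_abscissa_le:
  assumes "\<sigma> \<in> {a..1}" "order_fun f \<sigma> < (\<alpha> - 1) / p" "0 < p"
  shows "Lp_abscissa a f p \<alpha> \<le> \<sigma>"
  unfolding Lp_abscissa_def using assms Lp_integral_finite[OF assms]
  by (intro cInf_lower) (auto intro: bdd_belowI[of _ a])

text \<open>Convergence is known for order strictly below \<open>(\<alpha> - 1) / p\<close>. This
  strictness holds to the right of the level because \<open>1 < \<alpha>\<close> makes the value
  positive.\<close>

lemma Lp_abscissa_le_level:
  assumes "0 < p" "1 < \<alpha>"
  shows "Lp_abscissa a f p \<alpha> \<le> level ((\<alpha> - 1) / p)"
proof (rule field_le_epsilon)
  fix e :: real assume "0 < e"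
  define y where "y = (\<alpha> - 1) / p"
  define \<sigma> where "\<sigma> = min 1 (level y + e)"
  have y: "0 < y" using assms by (simp add: y_def)
  have \<sigma>: "\<sigma> \<in> {a..1}"
    using level_ge[of y] a_less_1 y \<open>0 < e\<close> by (simp add: \<sigma>_def)
  have "order_fun f \<sigma> < y"
    using \<mu>_above_level_strict[OF y \<sigma>] order_1 y \<open>0 < e\<close> by (cases "\<sigma> = 1") (auto simp: \<sigma>_def)
  then have "Lp_abscissa a f p \<alpha> \<le> \<sigma>"
    using Lp_abscissa_le \<sigma> assms by (simp add: y_def)
  then show "Lp_abscissa a f p \<alpha> \<le> level ((\<alpha> - 1) / p) + e"
    by (simp add: \<sigma>_def y_def)
qed

text \<open>To the right of a line of convergence the order is at most \<open>\<alpha> / p\<close>,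
  so the level is at most every such \<open>\<sigma>\<close>, hence at most
  \<open>\<sigma>1\<close>.\<close>

lemma level_le_Lp_abscissa:
  assumes "1 \<le> p" "1 < \<alpha>"
  shows "level (\<alpha> / p) \<le> Lp_abscissa a f p \<alpha>"
  unfolding Lp_abscissa_def
proof (rule cInf_greatest)
  have "Lp_integral f p \<alpha> 1 < \<infinity>"
    using a_less_1 order_1 assms by (intro Lp_integral_finite) auto
  then show "{\<sigma>\<in>{a..1}. Lp_integral f p \<alpha> \<sigma> < \<infinity>} \<noteq> {}"
    using a_less_1 by (auto intro!: exI[of _ 1])
next
  fix \<sigma>1 assume "\<sigma>1 \<in> {\<sigma>\<in>{a..1}. Lp_integral f p \<alpha> \<sigma> < \<infinity>}"
  then have \<sigma>1: "\<sigma>1 \<in> {a..1}" and fin: "Lp_integral f p \<alpha> \<sigma>1 < \<infinity>" by auto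
  show "level (\<alpha> / p) \<le> \<sigma>1"
  proof (cases "\<sigma>1 = 1")
    case True
    then show ?thesis using level_le_1[of "\<alpha> / p"] assms by simp
  next
    case False
    then have "\<sigma>1 < 1" using \<sigma>1 by simp
    then show ?thesis
    proof (rule dense_ge_bounded)
      fix \<sigma> assume \<sigma>: "\<sigma>1 < \<sigma>" "\<sigma> < 1"
      have "order_fun f \<sigma> \<le> \<alpha> / p"
        using assms \<sigma>1 \<sigma> order_1
        by (intro order_fun_le grows_if_Lp_integral_finite[OF fin]) auto
      then show "level (\<alpha> / p) \<le> \<sigma>" using \<sigma> \<sigma>1 by (intro level_lower) auto
    qed
  qed
qed

end

theorem theorem1:
  fixes a :: real and f :: "complex \<Rightarrow> complex"
  assumes "a < 1"
    and "f analytic_on half_strip a"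
    and "polynomially_bounded a f"
    and "0 < order_fun f a"
    and "order_fun f 1 = 0"
  shows "convex_on {\<sigma>\<in>{a..1}. 0 < order_fun f \<sigma>} (\<lambda>\<sigma>. 1 / order_fun f \<sigma>)
         \<longleftrightarrow> approximately_concave (order_fun f a) (Lp_abscissa a f)"
proof -
  interpret strip_function_order_0 a f
    using assms by unfold_locales
  show ?thesis
    using assms(4) level_le_Lp_abscissa Lp_abscissa_le_level
    by (rule convex_iff_approximately_concave)
qed

end
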